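(* Let $M$ be an invariant submanifold of a generalized Sasakian-space-form $\overline{M}^{2n+1}(f_1,f_2,f_3)$ with respect to the semi-symmetric metric connection, such that $(f_1-f_3)^2+1\neq 0$. Then the second fundamental form $h$ is recurrent with respect to the semi-symmetric metric connection if and only if $M$ is totally geodesic.
   Context: An almost contact metric manifold $(\overline M,\phi,\xi,\eta,g)$ is a Riemannian manifold $(\overline M,g)$ with a $(1,1)$-tensor field $\phi$, a vector field $\xi$ and a $1$-form $\eta$ such that $\phi^2X=-X+\eta(X)\xi$, $\phi\xi=0$, $\eta(\xi)=1$, $g(X,\xi)=\eta(X)$, $\eta(\phi X)=0$, $g(\phi X,\phi Y)=g(X,Y)-\eta(X)\eta(Y)$. Curvature convention: $R(X,Y)=[\nabla_X,\nabla_Y]-\nabla_{[X,Y]}$. A generalized Sasakian-space-form $\overline M^{2n+1}(f_1,f_2,f_3)$ is an almost contact metric manifold of dimension $2n+1$, $n>1$, with smooth functions $f_1,f_2,f_3$ on $\overline M$ such that the curvature tensor $\overline R$ of its Levi-Civita connection $\overline\nabla$ satisfies $\overline R(X,Y)Z=f_1\{g(Y,Z)X-g(X,Z)Y\}+f_2\{g(X,\phi Z)\phi Y-g(Y,\phi Z)\phi X+2g(X,\phi Y)\phi Z\}+f_3\{\eta(X)\eta(Z)Y-\eta(Y)\eta(Z)X+g(X,Z)\eta(Y)\xi-g(Y,Z)\eta(X)\xi\}.$ Throughout, the following structure equations also hold on $\overline M$: $(\overline\nabla_X\phi)(Y)=(f_1-f_3)[g(X,Y)\xi-\eta(Y)X]$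 and $\overline\nabla_X\xi=-(f_1-f_3)\phi X$. A submanifold $M$ of $\overline M$ is invariant if $\xi$ is tangent to $M$ and $\phi(TM)\subset TM$ at every point of $M$. With $\nabla$ the induced Levi-Civita connection, the second fundamental form $h$ is given by $\overline\nabla_XY=\nabla_XY+h(X,Y)$; $M$ is totally geodesic if $h=0$. The semi-symmetric metric connection on $\overline M$ is $\widetilde{\overline\nabla}_XY=\overline\nabla_XY+\eta(Y)X-g(X,Y)\xi$. Its induced connection on $M$ is $\widetilde\nabla_XY=\nabla_XY+\eta(Y)X-g(X,Y)\xi$, its second fundamental form on $M$ is again $h$, and $\widetilde\nabla^\perp$ denotes the connection it induces on the normal bundle, i.e. $\widetilde\nabla^\perp_XV$ is the normal part of $\widetilde{\overline\nabla}_XV$. Put $(\widetilde{\overline\nabla}_Xh)(Y,Z)=\widetilde\nabla^\perp_X(h(Y,Z))-h(\widetilde\nabla_XY,Z)-h(Y,\widetilde\nabla_XZ)$. Then $h$ is recurrent with respect to the semi-symmetric metric connection if there is a $1$-form $D$ on $M$ with $(\widetilde{\overline\nabla}_Xh)(Y,Z)=D(X)h(Y,Z)$ for all $X,Y,Z$ tangent to $M$. *)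

theory Defs
  imports "HOL-Analysis.Analysis" "HOL-Library.Function_Algebras"
begin

text \<open>
  Tangent vectors are represented as functionals on real-valued functions and vector fields as
  functions into tangent vectors, so the pointwise real vector space structure is needed on
  function types; \<^theory>\<open>HOL-Library.Function_Algebras\<close> provides only the additive part.
\<close>

instantiation "fun" :: (type, real_vector) real_vector
begin

definition scaleR_fun :: "real \<Rightarrow> ('a \<Rightarrow> 'b) \<Rightarrow> 'a \<Rightarrow> 'b" where
  "scaleR_fun c f = (\<lambda>x. c *\<^sub>R f x)"

instance
  by standard (auto simp: scaleR_fun_def fun_eq_iff algebra_simps)

end

definition linear_over :: "'u::real_vector set \<Rightarrow> ('u \<Rightarrow> 'w::real_vector) \<Rightarrow> bool" where
  "linear_over T F \<longleftrightarrow>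
     (\<forall>u\<in>T. \<forall>v\<in>T. F (u + v) = F u + F v) \<and> (\<forall>c. \<forall>u\<in>T. F (c *\<^sub>R u) = c *\<^sub>R F u)"


section \<open>Smooth manifolds\<close>

text \<open>Only meant for open sets \<open>S\<close>, where differentiability within \<open>S\<close> is differentiability.\<close>

primrec Ck_on ::
    "nat \<Rightarrow> 'u::real_normed_vector set \<Rightarrow> ('u \<Rightarrow> 'w::real_normed_vector) \<Rightarrow> bool" where
  "Ck_on 0 S f \<longleftrightarrow> continuous_on S f"
| "Ck_on (Suc k) S f \<longleftrightarrow>
     f differentiable_on S \<and> (\<forall>v. Ck_on k S (\<lambda>x. frechet_derivative f (at x) v))"

definition smooth_on :: "'u::real_normed_vector set \<Rightarrow> ('u \<Rightarrow> 'w::real_normed_vector) \<Rightarrow> bool" where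
  "smooth_on S f \<longleftrightarrow> (\<forall>k. Ck_on k S f)"

text \<open>
  A chart is a pair of its domain and its coordinate map. The carrier of a manifold is a whole
  type, Hausdorff and second countable; its dimension is the cardinality of the index type of
  the coordinates.
\<close>

type_synonym ('a, 'k) atlas = "('a set \<times> ('a \<Rightarrow> real ^ 'k)) set"

definition smooth_manifold ::
    "('a::{t2_space, second_countable_topology}, 'k::finite) atlas \<Rightarrow> bool" where
  "smooth_manifold A \<longleftrightarrow>
     (\<Union>(U, x)\<in>A. U) = UNIV \<and>
     (\<forall>(U, x)\<in>A. open U \<and> open (x ` U) \<and> homeomorphism U (x ` U) x (inv_into U x)) \<and>
     (\<forall>(U, x)\<in>A. \<forall>(V, y)\<in>A. smooth_on (x ` (U \<inter> V)) (y \<circ> inv_into U x))"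

definition smooth_functions :: "('a, 'k::finite) atlas \<Rightarrow> ('a \<Rightarrow> real) set" where
  "smooth_functions A = {f. \<forall>(U, x)\<in>A. smooth_on (x ` U) (f \<circ> inv_into U x)}"

definition smooth_map ::
    "('a::topological_space, 'k::finite) atlas \<Rightarrow> ('b::topological_space, 'l::finite) atlas
      \<Rightarrow> ('a \<Rightarrow> 'b) \<Rightarrow> bool" where
  "smooth_map A B \<iota> \<longleftrightarrow> continuous_on UNIV \<iota> \<and>
     (\<forall>(U, x)\<in>A. \<forall>(V, y)\<in>B. smooth_on (x ` (U \<inter> \<iota> -` V)) (y \<circ> \<iota> \<circ> inv_into U x))"

text \<open>
  Tangent vectors at \<open>p\<close> are the directional derivatives at \<open>p\<close> of smooth functions, computed in
  a chart around \<open>p\<close>. Non-smooth functions are sent to \<open>0\<close>, so that equality of tangent vectors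
  is equality of functionals.
\<close>

type_synonym 'a tangent = "('a \<Rightarrow> real) \<Rightarrow> real"
type_synonym 'a field = "'a \<Rightarrow> 'a tangent"

definition tangent_space :: "('a, 'k::finite) atlas \<Rightarrow> 'a \<Rightarrow> 'a tangent set" where
  "tangent_space A p =
     {(\<lambda>f. if f \<in> smooth_functions A
           then frechet_derivative (f \<circ> inv_into U x) (at (x p)) w else 0)
      | U x w. (U, x) \<in> A \<and> p \<in> U}"

text \<open>The differential of \<open>\<iota>\<close>; the base point need not be mentioned.\<close>

definition push :: "('b, 'l::finite) atlas \<Rightarrow> ('a \<Rightarrow> 'b) \<Rightarrow> 'a tangent \<Rightarrow> 'b tangent" where
  "push B \<iota> v = (\<lambda>f. if f \<in> smooth_functions B then v (f \<circ> \<iota>) else 0)"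

definition immersion ::
    "('a::topological_space, 'k::finite) atlas \<Rightarrow> ('b::topological_space, 'l::finite) atlas
      \<Rightarrow> ('a \<Rightarrow> 'b) \<Rightarrow> bool" where
  "immersion A B \<iota> \<longleftrightarrow> smooth_map A B \<iota> \<and> (\<forall>p. inj_on (push B \<iota>) (tangent_space A p))"

text \<open>Smooth vector fields along \<open>\<iota>\<close>, that is, smooth sections of the pullback bundle
  \<open>\<iota>\<^sup>*TB\<close>.\<close>

definition fields_along ::
    "('a, 'k::finite) atlas \<Rightarrow> ('b, 'l::finite) atlas \<Rightarrow> ('a \<Rightarrow> 'b) \<Rightarrow> ('a \<Rightarrow> 'b tangent) set" where
  "fields_along A B \<iota> =
     {V. (\<forall>p. V p \<in> tangent_space B (\<iota> p)) \<and>
         (\<forall>f\<in>smooth_functions B. (\<lambda>p. V p f) \<in> smooth_functions A)}"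

definition vector_fields :: "('a, 'k::finite) atlas \<Rightarrow> 'a field set" where
  "vector_fields A = fields_along A A id"

definition lie_bracket :: "('a, 'k::finite) atlas \<Rightarrow> 'a field \<Rightarrow> 'a field \<Rightarrow> 'a field" where
  "lie_bracket A X Y =
     (\<lambda>p f. if f \<in> smooth_functions A then X p (\<lambda>q. Y q f) - Y p (\<lambda>q. X q f) else 0)"

definition one_form :: "('a, 'k::finite) atlas \<Rightarrow> ('a \<Rightarrow> 'a tangent \<Rightarrow> real) \<Rightarrow> bool" where
  "one_form A \<omega> \<longleftrightarrow>
     (\<forall>p. linear_over (tangent_space A p) (\<omega> p)) \<and>
     (\<forall>X\<in>vector_fields A. (\<lambda>p. \<omega> p (X p)) \<in> smooth_functions A)"

definition tensor_field_1_1 ::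
    "('a, 'k::finite) atlas \<Rightarrow> ('a \<Rightarrow> 'a tangent \<Rightarrow> 'a tangent) \<Rightarrow> bool" where
  "tensor_field_1_1 A \<phi> \<longleftrightarrow>
     (\<forall>p. linear_over (tangent_space A p) (\<phi> p) \<and> \<phi> p ` tangent_space A p \<subseteq> tangent_space A p) \<and>
     (\<forall>X\<in>vector_fields A. (\<lambda>p. \<phi> p (X p)) \<in> vector_fields A)"


section \<open>Metrics and connections\<close>

type_synonym 'a metric = "'a \<Rightarrow> 'a tangent \<Rightarrow> 'a tangent \<Rightarrow> real"

definition riemannian_metric :: "('a, 'k::finite) atlas \<Rightarrow> 'a metric \<Rightarrow> bool" where
  "riemannian_metric A g \<longleftrightarrow>
     (\<forall>p. \<forall>u\<in>tangent_space A p.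
        linear_over (tangent_space A p) (g p u) \<and>
        (\<forall>v\<in>tangent_space A p. g p u v = g p v u) \<and>
        (u \<noteq> 0 \<longrightarrow> g p u u > 0)) \<and>
     (\<forall>X\<in>vector_fields A. \<forall>Y\<in>vector_fields A. (\<lambda>p. g p (X p) (Y p)) \<in> smooth_functions A)"

text \<open>
  Connections on \<open>\<iota>\<^sup>*TB\<close>: \<open>D p v V\<close> is the covariant derivative at \<open>p\<close> of the field \<open>V\<close> along
  \<open>\<iota>\<close> in the direction of the tangent vector \<open>v\<close> at \<open>p\<close>. For \<open>\<iota> = id\<close> these are the affine
  connections of \<open>A\<close>.
\<close>

type_synonym ('a, 'b) connection = "'a \<Rightarrow> 'a tangent \<Rightarrow> ('a \<Rightarrow> 'b tangent) \<Rightarrow> 'b tangent"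

definition connection_along ::
    "('a, 'k::finite) atlas \<Rightarrow> ('b, 'l::finite) atlas \<Rightarrow> ('a \<Rightarrow> 'b) \<Rightarrow> ('a, 'b) connection \<Rightarrow> bool" where
  "connection_along A B \<iota> D \<longleftrightarrow>
     (\<forall>V\<in>fields_along A B \<iota>. \<forall>p.
        linear_over (tangent_space A p) (\<lambda>v. D p v V) \<and>
        (\<forall>v\<in>tangent_space A p. D p v V \<in> tangent_space B (\<iota> p))) \<and>
     (\<forall>X\<in>vector_fields A. \<forall>V\<in>fields_along A B \<iota>. (\<lambda>p. D p (X p) V) \<in> fields_along A B \<iota>) \<and>
     (\<forall>p. \<forall>v\<in>tangent_space A p. \<forall>V\<in>fields_along A B \<iota>.
        (\<forall>W\<in>fields_along A B \<iota>. D p v (V + W) = D p v V + D p v W) \<and>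
        (\<forall>a\<in>smooth_functions A. D p v (\<lambda>q. a q *\<^sub>R V q) = v a *\<^sub>R V p + a p *\<^sub>R D p v V))"

definition cov :: "('a, 'b) connection \<Rightarrow> 'a field \<Rightarrow> ('a \<Rightarrow> 'b tangent) \<Rightarrow> ('a \<Rightarrow> 'b tangent)" where
  "cov D X V = (\<lambda>p. D p (X p) V)"

definition levi_civita :: "('a, 'k::finite) atlas \<Rightarrow> 'a metric \<Rightarrow> ('a, 'a) connection \<Rightarrow> bool" where
  "levi_civita A g D \<longleftrightarrow>
     connection_along A A id D \<and>
     (\<forall>X\<in>vector_fields A. \<forall>Y\<in>vector_fields A. cov D X Y - cov D Y X = lie_bracket A X Y) \<and>
     (\<forall>X\<in>vector_fields A. \<forall>Y\<in>vector_fields A. \<forall>Z\<in>vector_fields A. \<forall>p.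
        X p (\<lambda>q. g q (Y q) (Z q)) = g p (cov D X Y p) (Z p) + g p (Y p) (cov D X Z p))"

definition curvature ::
    "('a, 'k::finite) atlas \<Rightarrow> ('a, 'a) connection \<Rightarrow> 'a field \<Rightarrow> 'a field \<Rightarrow> 'a field \<Rightarrow> 'a field" where
  "curvature A D X Y Z =
     cov D X (cov D Y Z) - cov D Y (cov D X Z) - cov D (lie_bracket A X Y) Z"

text \<open>
  The pullback to \<open>\<iota>\<^sup>*TB\<close> of an affine connection \<open>D'\<close> of \<open>B\<close>; the chain rule below determines
  it uniquely. It makes sense of \<open>D'\<^sub>X V\<close> for \<open>X\<close> tangent to the submanifold and \<open>V\<close> defined
  only along it.
\<close>

definition pullback_connection ::
    "('a, 'k::finite) atlas \<Rightarrow> ('b, 'l::finite) atlas \<Rightarrow> ('a \<Rightarrow> 'b)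
      \<Rightarrow> ('b, 'b) connection \<Rightarrow> ('a, 'b) connection \<Rightarrow> bool" where
  "pullback_connection A B \<iota> D' D \<longleftrightarrow>
     connection_along A B \<iota> D \<and>
     (\<forall>p. \<forall>v\<in>tangent_space A p. \<forall>Y\<in>vector_fields B. D p v (Y \<circ> \<iota>) = D' (\<iota> p) (push B \<iota> v) Y)"

definition semi_symmetric ::
    "'a metric \<Rightarrow> ('a \<Rightarrow> 'a tangent \<Rightarrow> real) \<Rightarrow> 'a field \<Rightarrow> ('a, 'a) connection \<Rightarrow> ('a, 'a) connection" where
  "semi_symmetric g \<eta> \<xi> D =
     (\<lambda>p v Y. D p v Y + \<eta> p (Y p) *\<^sub>R v - g p v (Y p) *\<^sub>R \<xi> p)"


section \<open>Generalized Sasakian-space-forms\<close>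

definition almost_contact_metric ::
    "('a, 'k::finite) atlas \<Rightarrow> 'a metric \<Rightarrow> ('a \<Rightarrow> 'a tangent \<Rightarrow> 'a tangent) \<Rightarrow> 'a field
      \<Rightarrow> ('a \<Rightarrow> 'a tangent \<Rightarrow> real) \<Rightarrow> bool" where
  "almost_contact_metric A g \<phi> \<xi> \<eta> \<longleftrightarrow>
     riemannian_metric A g \<and> tensor_field_1_1 A \<phi> \<and> \<xi> \<in> vector_fields A \<and> one_form A \<eta> \<and>
     (\<forall>p. \<phi> p (\<xi> p) = 0 \<and> \<eta> p (\<xi> p) = 1 \<and>
        (\<forall>u\<in>tangent_space A p.
           \<phi> p (\<phi> p u) = - u + \<eta> p u *\<^sub>R \<xi> p \<and>
           g p u (\<xi> p) = \<eta> p u \<and>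
           \<eta> p (\<phi> p u) = 0 \<and>
           (\<forall>v\<in>tangent_space A p. g p (\<phi> p u) (\<phi> p v) = g p u v - \<eta> p u * \<eta> p v)))"

definition generalized_sasakian_space_form ::
    "nat \<Rightarrow> ('a::{t2_space, second_countable_topology}, 'k::finite) atlas \<Rightarrow> 'a metric
      \<Rightarrow> ('a \<Rightarrow> 'a tangent \<Rightarrow> 'a tangent) \<Rightarrow> 'a field \<Rightarrow> ('a \<Rightarrow> 'a tangent \<Rightarrow> real)
      \<Rightarrow> ('a \<Rightarrow> real) \<Rightarrow> ('a \<Rightarrow> real) \<Rightarrow> ('a \<Rightarrow> real) \<Rightarrow> ('a, 'a) connection \<Rightarrow> bool" where
  "generalized_sasakian_space_form n A g \<phi> \<xi> \<eta> f1 f2 f3 D \<longleftrightarrow>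
     smooth_manifold A \<and> CARD('k) = 2 * n + 1 \<and> n > 1 \<and>
     almost_contact_metric A g \<phi> \<xi> \<eta> \<and>
     f1 \<in> smooth_functions A \<and> f2 \<in> smooth_functions A \<and> f3 \<in> smooth_functions A \<and>
     levi_civita A g D \<and>
     (\<forall>X\<in>vector_fields A. \<forall>Y\<in>vector_fields A. \<forall>Z\<in>vector_fields A. \<forall>p.
        curvature A D X Y Z p =
          f1 p *\<^sub>R (g p (Y p) (Z p) *\<^sub>R X p - g p (X p) (Z p) *\<^sub>R Y p)
        + f2 p *\<^sub>R (g p (X p) (\<phi> p (Z p)) *\<^sub>R \<phi> p (Y p)
                  - g p (Y p) (\<phi> p (Z p)) *\<^sub>R \<phi> p (X p)
                  + (2 * g p (X p) (\<phi> p (Y p))) *\<^sub>R \<phi> p (Z p))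
        + f3 p *\<^sub>R ((\<eta> p (X p) * \<eta> p (Z p)) *\<^sub>R Y p
                  - (\<eta> p (Y p) * \<eta> p (Z p)) *\<^sub>R X p
                  + (g p (X p) (Z p) * \<eta> p (Y p)) *\<^sub>R \<xi> p
                  - (g p (Y p) (Z p) * \<eta> p (X p)) *\<^sub>R \<xi> p))"

definition structure_equations ::
    "('a, 'k::finite) atlas \<Rightarrow> 'a metric \<Rightarrow> ('a \<Rightarrow> 'a tangent \<Rightarrow> 'a tangent) \<Rightarrow> 'a field
      \<Rightarrow> ('a \<Rightarrow> 'a tangent \<Rightarrow> real) \<Rightarrow> ('a \<Rightarrow> real) \<Rightarrow> ('a \<Rightarrow> real) \<Rightarrow> ('a, 'a) connection \<Rightarrow> bool" where
  "structure_equations A g \<phi> \<xi> \<eta> f1 f3 D \<longleftrightarrow>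
     (\<forall>X\<in>vector_fields A. \<forall>p.
        (\<forall>Y\<in>vector_fields A.
           cov D X (\<lambda>q. \<phi> q (Y q)) p - \<phi> p (cov D X Y p) =
             (f1 p - f3 p) *\<^sub>R (g p (X p) (Y p) *\<^sub>R \<xi> p - \<eta> p (Y p) *\<^sub>R X p)) \<and>
        cov D X \<xi> p = - (f1 p - f3 p) *\<^sub>R \<phi> p (X p))"


section \<open>Submanifolds\<close>

text \<open>A submanifold of \<open>B\<close> is a manifold \<open>A\<close> with an immersion \<open>\<iota>\<close> into \<open>B\<close>.\<close>

definition induced_metric :: "('b, 'l::finite) atlas \<Rightarrow> ('a \<Rightarrow> 'b) \<Rightarrow> 'b metric \<Rightarrow> 'a metric" where
  "induced_metric B \<iota> g = (\<lambda>p u v. g (\<iota> p) (push B \<iota> u) (push B \<iota> v))"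

definition induced_form ::
    "('b, 'l::finite) atlas \<Rightarrow> ('a \<Rightarrow> 'b) \<Rightarrow> ('b \<Rightarrow> 'b tangent \<Rightarrow> real) \<Rightarrow> 'a \<Rightarrow> 'a tangent \<Rightarrow> real" where
  "induced_form B \<iota> \<eta> = (\<lambda>p u. \<eta> (\<iota> p) (push B \<iota> u))"

text \<open>The restriction of a field of \<open>B\<close> that is tangent to the submanifold, as a field of \<open>A\<close>.\<close>

definition induced_field ::
    "('a, 'k::finite) atlas \<Rightarrow> ('b, 'l::finite) atlas \<Rightarrow> ('a \<Rightarrow> 'b) \<Rightarrow> 'b field \<Rightarrow> 'a field" where
  "induced_field A B \<iota> \<xi> = (\<lambda>p. the_inv_into (tangent_space A p) (push B \<iota>) (\<xi> (\<iota> p)))"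

definition invariant_submanifold ::
    "('a::{t2_space, second_countable_topology}, 'k::finite) atlas
      \<Rightarrow> ('b::topological_space, 'l::finite) atlas \<Rightarrow> ('a \<Rightarrow> 'b)
      \<Rightarrow> ('b \<Rightarrow> 'b tangent \<Rightarrow> 'b tangent) \<Rightarrow> 'b field \<Rightarrow> bool" where
  "invariant_submanifold A B \<iota> \<phi> \<xi> \<longleftrightarrow>
     smooth_manifold A \<and> immersion A B \<iota> \<and>
     (\<forall>p. \<xi> (\<iota> p) \<in> push B \<iota> ` tangent_space A p \<and>
          \<phi> (\<iota> p) ` push B \<iota> ` tangent_space A p \<subseteq> push B \<iota> ` tangent_space A p)"

definition normal_space ::
    "('a, 'k::finite) atlas \<Rightarrow> ('b, 'l::finite) atlas \<Rightarrow> ('a \<Rightarrow> 'b) \<Rightarrow> 'b metric \<Rightarrow> 'a \<Rightarrow> 'b tangent set" where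
  "normal_space A B \<iota> g p =
     {w \<in> tangent_space B (\<iota> p). \<forall>v\<in>tangent_space A p. g (\<iota> p) w (push B \<iota> v) = 0}"

definition normal_part ::
    "('a, 'k::finite) atlas \<Rightarrow> ('b, 'l::finite) atlas \<Rightarrow> ('a \<Rightarrow> 'b) \<Rightarrow> 'b metric
      \<Rightarrow> 'a \<Rightarrow> 'b tangent \<Rightarrow> 'b tangent" where
  "normal_part A B \<iota> g p w =
     (THE w'. w' \<in> normal_space A B \<iota> g p \<and> w - w' \<in> push B \<iota> ` tangent_space A p)"

text \<open>
  In the following, \<open>DI\<close> is the Levi-Civita connection of the ambient manifold pulled back along
  \<open>\<iota>\<close>, \<open>DM\<close> the Levi-Civita connection of the induced metric, \<open>SI\<close> the ambient semi-symmetric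
  metric connection pulled back along \<open>\<iota>\<close>, and \<open>SM\<close> the connection it induces on the submanifold.
  The first definition is the Gauss formula solved for the second fundamental form.
\<close>

definition second_fundamental_form ::
    "('b, 'l::finite) atlas \<Rightarrow> ('a \<Rightarrow> 'b) \<Rightarrow> ('a, 'b) connection \<Rightarrow> ('a, 'a) connection
      \<Rightarrow> 'a field \<Rightarrow> 'a field \<Rightarrow> ('a \<Rightarrow> 'b tangent)" where
  "second_fundamental_form B \<iota> DI DM X Y =
     cov DI X (push B \<iota> \<circ> Y) - (push B \<iota> \<circ> cov DM X Y)"

definition totally_geodesic ::
    "('a, 'k::finite) atlas \<Rightarrow> ('a field \<Rightarrow> 'a field \<Rightarrow> ('a \<Rightarrow> 'b tangent)) \<Rightarrow> bool" where
  "totally_geodesic A h \<longleftrightarrow> (\<forall>X\<in>vector_fields A. \<forall>Y\<in>vector_fields A. h X Y = 0)"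

definition cov_second_form ::
    "('a, 'k::finite) atlas \<Rightarrow> ('b, 'l::finite) atlas \<Rightarrow> ('a \<Rightarrow> 'b) \<Rightarrow> 'b metric
      \<Rightarrow> ('a, 'b) connection \<Rightarrow> ('a, 'a) connection
      \<Rightarrow> ('a field \<Rightarrow> 'a field \<Rightarrow> ('a \<Rightarrow> 'b tangent))
      \<Rightarrow> 'a field \<Rightarrow> 'a field \<Rightarrow> 'a field \<Rightarrow> ('a \<Rightarrow> 'b tangent)" where
  "cov_second_form A B \<iota> g SI SM h X Y Z =
     (\<lambda>p. normal_part A B \<iota> g p (cov SI X (h Y Z) p)) - h (cov SM X Y) Z - h Y (cov SM X Z)"

definition recurrent ::
    "('a, 'k::finite) atlas \<Rightarrow> ('b, 'l::finite) atlas \<Rightarrow> ('a \<Rightarrow> 'b) \<Rightarrow> 'b metric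
      \<Rightarrow> ('a, 'b) connection \<Rightarrow> ('a, 'a) connection
      \<Rightarrow> ('a field \<Rightarrow> 'a field \<Rightarrow> ('a \<Rightarrow> 'b tangent)) \<Rightarrow> bool" where
  "recurrent A B \<iota> g SI SM h \<longleftrightarrow>
     (\<exists>\<omega>. one_form A \<omega> \<and>
        (\<forall>X\<in>vector_fields A. \<forall>Y\<in>vector_fields A. \<forall>Z\<in>vector_fields A. \<forall>p.
           cov_second_form A B \<iota> g SI SM h X Y Z p = \<omega> p (X p) *\<^sub>R h Y Z p))"

end

theory Submission
  imports Defs
begin

text \<open>
  Write \<open>a = f\<^sub>1 - f\<^sub>3\<close>. On an invariant submanifold \<open>\<nabla>\<^sub>Y \<xi> = - a \<phi>Y\<close> is tangent, so
  \<open>h(Y, \<xi>) = 0\<close>. Recurrence with \<open>Z = \<xi>\<close> therefore reads \<open>h(Y, \<nabla>'\<^sub>X \<xi>) = 0\<close>, where \<open>\<nabla>'\<close> is the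
  induced semi-symmetric connection and \<open>\<nabla>'\<^sub>X \<xi> = - a \<phi>X + X - \<eta>(X) \<xi>\<close>, that is,
  \<open>h(X, Y) = a h(\<phi>X, Y)\<close>. Using this twice together with \<open>\<phi>\<^sup>2 X = - X + \<eta>(X) \<xi>\<close> gives
  \<open>(a\<^sup>2 + 1) h = 0\<close>.

  The tangential part of the pulled back Levi-Civita connection is the Levi-Civita connection of
  the induced metric because the pulled back connection is torsion-free and metric. All statements
  about fields along the immersion are reduced to ambient fields by means of global identities
  \<open>\<beta> v = \<Sum>\<^sub>j v(u\<^sub>j) E\<^sub>j\<close> with smooth functions \<open>\<beta>\<close>, \<open>u\<^sub>j\<close> and vector fields \<open>E\<^sub>j\<close>, where \<open>\<beta>\<close>
  does not vanish at a given point; this replaces localisation.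
\<close>

section \<open>Calculus of \<open>C\<^sup>k\<close> functions\<close>

text \<open>The obstacle is that connections, tensors and forms act on global fields only, while a
  field along \<iota> is in general not the restriction of an ambient field: neither chart
  components nor an extension of the whole field can be fed to a connection. A factor \<beta>
  supported in a chart is carried through each computation instead. The Leibniz rule turns the
  derivative of \<beta> V into derivatives of ambient fields, and the factor is cancelled at a point
  where it is nonzero. Smoothness, torsion and metric compatibility are all settled this way.

  The form \<open>h\<close> is defined as a difference of two connections, so its symmetry and
  normality are theorems. Normality is what yields h(Y, \<xi>) = 0, since a vector that is both
  tangential and normal vanishes. As this holds at every point, the normal connection in the
  recurrence with Z = \<xi> differentiates a zero field.\<close>

lemma Ck_on_SucD': "Ck_on (Suc k) S f \<Longrightarrow> Ck_on k S (\<lambda>x. frechet_derivative f (at x) v)"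
  by simp

text \<open>\<open>Ck_on\<close> uses derivatives in the whole space, so agreement on
  \<open>S\<close> passes to derivatives because \<open>S\<close> is open.\<close>

lemma Ck_on_cong:
  assumes "open S" "\<And>x. x \<in> S \<Longrightarrow> f x = g x" "Ck_on k S f"
  shows "Ck_on k S g"
  using assms(2,3)
proof (induction k arbitrary: f g)
  case 0
  then show ?case using continuous_on_cong by force
next
  case (Suc k)
  have *: "(g has_derivative frechet_derivative f (at x)) (at x)" if "x \<in> S" for x
  proof (rule has_derivative_transform_within_open[OF _ assms(1) that])
    show "(f has_derivative frechet_derivative f (at x)) (at x)"
      using Suc.prems(2) that \<open>open S\<close> frechet_derivative_works
      by (auto simp: differentiable_on_eq_differentiable_at)
  qed (use Suc.prems in auto)
  have "frechet_derivative f (at x) v = frechet_derivative g (at x) v" if "x \<in> S" for x v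
    using frechet_derivative_at[OF *[OF that]] by (rule fun_cong)
  then have "Ck_on k S (\<lambda>x. frechet_derivative g (at x) v)" for v
    by (intro Suc.IH[of "\<lambda>x. frechet_derivative f (at x) v", OF _ Ck_on_SucD'[OF Suc.prems(2)]])
  moreover have "g differentiable_on S"
    using * by (meson differentiable_at_imp_differentiable_on differentiable_def)
  ultimately show ?case by simp
qed

text \<open>Lets the recursion run on a derivative known in closed form instead of on the choice
  term \<open>frechet_derivative\<close>; the calculus rules below rest on it.\<close>

lemma Ck_on_SucI:
  assumes "open S" "\<And>x. x \<in> S \<Longrightarrow> (f has_derivative f' x) (at x)"
    and "\<And>v. Ck_on k S (\<lambda>x. f' x v)"
  shows "Ck_on (Suc k) S f"
proof -
  have "f' x v = frechet_derivative f (at x) v" if "x \<in> S" for x v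
    using frechet_derivative_at[OF assms(2)[OF that]] by simp
  then have "Ck_on k S (\<lambda>x. frechet_derivative f (at x) v)" for v
    by (intro Ck_on_cong[OF assms(1) _ assms(3)[of v]]) auto
  moreover have "f differentiable_on S"
    using assms(2) by (meson differentiable_at_imp_differentiable_on differentiable_def)
  ultimately show ?thesis by simp
qed

lemma Ck_on_SucD:
  assumes "Ck_on (Suc k) S f" "open S" "x \<in> S"
  shows "(f has_derivative frechet_derivative f (at x)) (at x)"
  using assms frechet_derivative_works by (auto simp: differentiable_on_eq_differentiable_at)

lemma Ck_on_Suc_imp: "Ck_on (Suc k) S f \<Longrightarrow> Ck_on k S f"
  by (induction k arbitrary: f) (use differentiable_imp_continuous_on in auto)

lemma Ck_on_subset:
  assumes "Ck_on k S f" "T \<subseteq> S"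
  shows "Ck_on k T f"
  using assms(1)
  by (induction k arbitrary: f)
     (auto intro: continuous_on_subset[OF _ assms(2)] differentiable_on_subset[OF _ assms(2)])

lemma Ck_on_local:
  assumes "\<And>x. x \<in> S \<Longrightarrow> \<exists>T. open T \<and> x \<in> T \<and> T \<subseteq> S \<and> Ck_on k T f" "open S"
  shows "Ck_on k S f"
  using assms(1)
proof (induction k arbitrary: f)
  case 0
  then show ?case
    by (auto simp: continuous_on_eq_continuous_at[OF \<open>open S\<close>]) (metis continuous_on_eq_continuous_at)
next
  case (Suc k)
  have "f differentiable_on S"
    using Suc.prems
    by (auto simp: differentiable_on_eq_differentiable_at[OF \<open>open S\<close>])
       (metis differentiable_on_eq_differentiable_at)
  moreover have "Ck_on k S (\<lambda>x. frechet_derivative f (at x) v)" for v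
    by (rule Suc.IH) (use Suc.prems in force)
  ultimately show ?case by simp
qed

lemma Ck_on_const [simp]: "Ck_on k S (\<lambda>x. c)"
  by (induction k arbitrary: c) (auto simp: frechet_derivative_const)

lemma Ck_on_bounded_linear:
  assumes "bounded_linear L" "open S"
  shows "Ck_on k S L"
proof (cases k)
  case 0
  then show ?thesis by (simp add: linear_continuous_on[OF assms(1)])
next
  case (Suc j)
  show ?thesis unfolding Suc
    by (rule Ck_on_SucI[OF assms(2) bounded_linear_imp_has_derivative[OF assms(1)] ]) auto
qed

lemma Ck_on_add:
  assumes "open S" "Ck_on k S f" "Ck_on k S g"
  shows "Ck_on k S (\<lambda>x. f x + g x)"
  using assms(2,3)
proof (induction k arbitrary: f g)
  case 0
  then show ?case by (auto intro: continuous_on_add)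
next
  case (Suc k)
  show ?case
    by (rule Ck_on_SucI[OF assms(1) has_derivative_add],
        erule Ck_on_SucD[OF Suc.prems(1) assms(1)], erule Ck_on_SucD[OF Suc.prems(2) assms(1)])
       (use Suc in auto)
qed

lemma Ck_on_sum:
  assumes "open S" "\<And>i. i \<in> I \<Longrightarrow> Ck_on k S (f i)"
  shows "Ck_on k S (\<lambda>x. \<Sum>i\<in>I. f i x)"
  using assms(2) by (induction I rule: infinite_finite_induct) (auto intro: Ck_on_add[OF assms(1)])

text \<open>The derivative of B(f, g) is a sum of two terms of the same shape with one argument
  differentiated, so the induction hypothesis applies once the other argument is lowered to order
  k.\<close>

lemma Ck_on_bilinear:
  assumes "bounded_bilinear B" "open S" "Ck_on k S f" "Ck_on k S g"
  shows "Ck_on k S (\<lambda>x. B (f x) (g x))"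
  using assms(3,4)
proof (induction k arbitrary: f g)
  case 0
  then show ?case by (auto intro: bounded_bilinear.continuous_on[OF assms(1)])
next
  case (Suc k)
  have k: "Ck_on k S f" "Ck_on k S g"
    using Suc.prems by (auto dest: Ck_on_Suc_imp simp del: Ck_on.simps(2))
  show ?case
    by (rule Ck_on_SucI[OF assms(2) bounded_bilinear.FDERIV[OF assms(1)]],
        erule Ck_on_SucD[OF Suc.prems(1) assms(2)], erule Ck_on_SucD[OF Suc.prems(2) assms(2)])
       (intro Ck_on_add[OF assms(2)] Suc.IH k Ck_on_SucD'[OF Suc.prems(1)]
          Ck_on_SucD'[OF Suc.prems(2)])
qed

lemmas Ck_on_mult = Ck_on_bilinear[OF bounded_bilinear_mult]

text \<open>\<open>Ck_on\<close> speaks of derivatives in a fixed direction, but the chain rule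
  produces Df(g x) in the direction Dg(x)v, which moves with x. Expanding that direction in a basis
  leaves sums of products with fixed directions; hence the Euclidean domain of
  \<open>f\<close>.\<close>

lemma Ck_on_compose:
  fixes f :: "'u::euclidean_space \<Rightarrow> 'w::real_normed_vector" and g :: "'t::real_normed_vector \<Rightarrow> 'u"
  assumes "open S" "open T" "g ` S \<subseteq> T" "Ck_on k T f" "Ck_on k S g"
  shows "Ck_on k S (\<lambda>x. f (g x))"
  using assms(4,5)
proof (induction k arbitrary: f)
  case 0
  then show ?case using continuous_on_compose2 assms(3) by auto
next
  case (Suc k)
  let ?Df = "\<lambda>y. frechet_derivative f (at y)" and ?Dg = "\<lambda>x. frechet_derivative g (at x)"
  have der: "((\<lambda>x. f (g x)) has_derivative (\<lambda>v. \<Sum>i\<in>Basis. (?Dg x v \<bullet> i) *\<^sub>R ?Df (g x) i)) (at x)"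
    if "x \<in> S" for x
  proof -
    have f: "(f has_derivative ?Df (g x)) (at (g x))"
      using Ck_on_SucD[OF Suc.prems(1) assms(2)] that assms(3) by blast
    have "((\<lambda>x. f (g x)) has_derivative (\<lambda>v. ?Df (g x) (?Dg x v))) (at x)"
      using has_derivative_compose[OF Ck_on_SucD[OF Suc.prems(2) assms(1) that] f] .
    moreover have *: "?Df (g x) w = (\<Sum>i\<in>Basis. (w \<bullet> i) *\<^sub>R ?Df (g x) i)" for w
    proof -
      have "linear (?Df (g x))" using f has_derivative_linear by blast
      then have "?Df (g x) (\<Sum>i\<in>Basis. (w \<bullet> i) *\<^sub>R i) = (\<Sum>i\<in>Basis. (w \<bullet> i) *\<^sub>R ?Df (g x) i)"
        by (simp add: linear_sum linear_cmul)
      then show ?thesis by (simp add: euclidean_representation)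
    qed
    have "(\<lambda>v. ?Df (g x) (?Dg x v)) = (\<lambda>v. \<Sum>i\<in>Basis. (?Dg x v \<bullet> i) *\<^sub>R ?Df (g x) i)"
      by (rule ext) (rule *)
    ultimately show ?thesis by simp
  qed
  show ?case
  proof (rule Ck_on_SucI[OF assms(1) der])
    fix v
    show "Ck_on k S (\<lambda>x. \<Sum>i\<in>Basis. (?Dg x v \<bullet> i) *\<^sub>R ?Df (g x) i)"
    proof (intro Ck_on_sum[OF assms(1)] Ck_on_bilinear[OF bounded_bilinear_scaleR assms(1)])
      fix i :: 'u
      show "Ck_on k S (\<lambda>x. ?Dg x v \<bullet> i)"
        by (rule Ck_on_bilinear[OF bounded_bilinear_inner assms(1)]) (use Suc.prems in auto)
      show "Ck_on k S (\<lambda>x. ?Df (g x) i)"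
        by (rule Suc.IH[OF Ck_on_SucD'[OF Suc.prems(1)] Ck_on_Suc_imp[OF Suc.prems(2)]])
    qed
  qed
qed

text \<open>The derivative - f' / f^2 is built from f' and 1 / f, and the induction hypothesis
  supplies 1 / f to order k.\<close>

lemma Ck_on_inverse:
  fixes f :: "'u::real_normed_vector \<Rightarrow> real"
  assumes "open S" "\<And>x. x \<in> S \<Longrightarrow> f x \<noteq> 0" "Ck_on k S f"
  shows "Ck_on k S (\<lambda>x. inverse (f x))"
  using assms(3)
proof (induction k)
  case 0
  then show ?case using assms(2) by (auto intro: continuous_on_inverse)
next
  case (Suc k)
  have IH: "Ck_on k S (\<lambda>x. inverse (f x))"
    using Suc Ck_on_Suc_imp by blast
  have "Ck_on k S (\<lambda>x. - 1 * (inverse (f x) * frechet_derivative f (at x) v * inverse (f x)))" for v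
    by (intro Ck_on_mult[OF assms(1)] Ck_on_const IH) (use Suc.prems in auto)
  moreover have "((\<lambda>x. inverse (f x)) has_derivative
      (\<lambda>v. - (inverse (f x) * frechet_derivative f (at x) v * inverse (f x)))) (at x)" if "x \<in> S" for x
    by (rule Deriv.has_derivative_inverse[OF assms(2) Ck_on_SucD[OF Suc.prems assms(1)]]) fact+
  ultimately show ?case by (intro Ck_on_SucI[OF assms(1)]) auto
qed

section \<open>Smoothness as being C^k for every k\<close>

lemma smooth_on_cong: "open S \<Longrightarrow> (\<And>x. x \<in> S \<Longrightarrow> f x = g x) \<Longrightarrow> smooth_on S f \<Longrightarrow> smooth_on S g"
  unfolding smooth_on_def using Ck_on_cong by blast

lemma smooth_on_subset: "smooth_on S f \<Longrightarrow> T \<subseteq> S \<Longrightarrow> smooth_on T f"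
  unfolding smooth_on_def using Ck_on_subset by blast

lemma smooth_on_local:
  assumes "\<And>x. x \<in> S \<Longrightarrow> \<exists>T. open T \<and> x \<in> T \<and> T \<subseteq> S \<and> smooth_on T f" "open S"
  shows "smooth_on S f"
  unfolding smooth_on_def
proof (intro allI Ck_on_local assms(2))
  fix k x assume "x \<in> S"
  then show "\<exists>T. open T \<and> x \<in> T \<and> T \<subseteq> S \<and> Ck_on k T f"
    using assms(1)[of x] by (auto simp: smooth_on_def)
qed

lemma smooth_on_const [simp]: "smooth_on S (\<lambda>x. c)"
  unfolding smooth_on_def by simp

lemma smooth_on_bounded_linear: "bounded_linear L \<Longrightarrow> open S \<Longrightarrow> smooth_on S L"
  unfolding smooth_on_def using Ck_on_bounded_linear by blast

lemma smooth_on_add: "open S \<Longrightarrow> smooth_on S f \<Longrightarrow> smooth_on S g \<Longrightarrow> smooth_on S (\<lambda>x. f x + g x)"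
  unfolding smooth_on_def using Ck_on_add by blast

lemma smooth_on_bilinear:
  "bounded_bilinear B \<Longrightarrow> open S \<Longrightarrow> smooth_on S f \<Longrightarrow> smooth_on S g \<Longrightarrow> smooth_on S (\<lambda>x. B (f x) (g x))"
  unfolding smooth_on_def using Ck_on_bilinear by blast

lemmas smooth_on_mult = smooth_on_bilinear[OF bounded_bilinear_mult]

lemma smooth_on_compose:
  fixes f :: "'u::euclidean_space \<Rightarrow> 'w::real_normed_vector" and g :: "'t::real_normed_vector \<Rightarrow> 'u"
  shows "open S \<Longrightarrow> open T \<Longrightarrow> g ` S \<subseteq> T \<Longrightarrow> smooth_on T f \<Longrightarrow> smooth_on S g \<Longrightarrow> smooth_on S (\<lambda>x. f (g x))"
  unfolding smooth_on_def using Ck_on_compose by blast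

lemma smooth_on_inverse:
  fixes f :: "'u::real_normed_vector \<Rightarrow> real"
  shows "open S \<Longrightarrow> (\<And>x. x \<in> S \<Longrightarrow> f x \<noteq> 0) \<Longrightarrow> smooth_on S f \<Longrightarrow> smooth_on S (\<lambda>x. inverse (f x))"
  unfolding smooth_on_def using Ck_on_inverse by blast

lemma smooth_on_has_derivative:
  "smooth_on S f \<Longrightarrow> open S \<Longrightarrow> x \<in> S \<Longrightarrow> (f has_derivative frechet_derivative f (at x)) (at x)"
  unfolding smooth_on_def using Ck_on_SucD by blast

lemma smooth_on_derivative: "smooth_on S f \<Longrightarrow> smooth_on S (\<lambda>x. frechet_derivative f (at x) v)"
  unfolding smooth_on_def using Ck_on_SucD' by blast

lemma smooth_on_imp_continuous_on: "smooth_on S f \<Longrightarrow> continuous_on S f"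
  unfolding smooth_on_def by (metis Ck_on.simps(1))

section \<open>Bump functions\<close>

text \<open>The derivatives of \<open>exp (- 1 / t)\<close>, extended by \<open>0\<close>, are combinations of these functions.\<close>

definition flat :: "nat \<Rightarrow> real \<Rightarrow> real" where
  "flat n t = (if t \<le> 0 then 0 else inverse t ^ n * exp (- inverse t))"

lemma flat_has_derivative:
  "(flat n has_real_derivative flat (n + 2) t - n * flat (n + 1) t) (at t)"
proof -
  consider "t < 0" | "t > 0" | "t = 0" by linarith
  then show ?thesis
  proof cases
    case 1
    have "((\<lambda>t. 0) has_real_derivative 0) (at t)" by simp
    then have "(flat n has_real_derivative 0) (at t)"
      by (rule DERIV_cong_ev[THEN iffD1, OF refl _ refl, rotated])
         (use 1 in \<open>auto simp: flat_def eventually_nhds intro!: exI[of _ "{..<0}"]\<close>)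
    then show ?thesis using 1 by (simp add: flat_def)
  next
    case 2
    have "((\<lambda>t. inverse t ^ n * exp (- inverse t)) has_real_derivative
        flat (n + 2) t - n * flat (n + 1) t) (at t)"
      using 2 by (auto intro!: derivative_eq_intros simp: flat_def field_simps power2_eq_square)
         (cases n; simp add: field_simps)
    then show ?thesis
      by (rule DERIV_cong_ev[THEN iffD1, OF refl _ refl, rotated])
         (use 2 in \<open>auto simp: flat_def eventually_nhds intro!: exI[of _ "{0<..}"]\<close>)
  next
    case 3
    \<comment> \<open>At 0 the difference quotient is \<open>flat n t / t\<close>; from the right, s
      = 1 / t turns it into s^(n+1) / exp s.\<close>
    have "((\<lambda>s. s ^ (n + 1) / exp s) \<longlongrightarrow> (0::real)) at_top"
      by (rule tendsto_power_div_exp_0)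
    then have "((\<lambda>t. inverse t ^ (n + 1) / exp (inverse t)) \<longlongrightarrow> (0::real)) (at_right 0)"
      by (rule filterlim_compose) (rule filterlim_inverse_at_top_right)
    then have "((\<lambda>t. flat n t / t) \<longlongrightarrow> 0) (at_right 0)"
      by (rule filterlim_cong[OF refl refl, THEN iffD1, rotated])
         (auto simp: eventually_at_filter flat_def field_simps exp_minus)
    moreover have "((\<lambda>t. flat n t / t) \<longlongrightarrow> 0) (at_left 0)"
      by (rule filterlim_cong[OF refl refl, THEN iffD1, OF _ tendsto_const])
         (auto simp: eventually_at_filter flat_def)
    ultimately have "((\<lambda>t. flat n t / t) \<longlongrightarrow> 0) (at 0)"
      by (simp add: filterlim_split_at)
    then show ?thesis using 3 by (simp add: has_field_derivative_iff flat_def)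
  qed
qed

lemma Ck_on_flat: "Ck_on k UNIV (flat n)"
proof (induction k arbitrary: n)
  case 0
  show ?case using flat_has_derivative DERIV_isCont
    by (metis Ck_on.simps(1) continuous_at_imp_continuous_on)
next
  case (Suc k)
  have "Ck_on k UNIV (\<lambda>x. (flat (n + 2) x + (- real n) * flat (n + 1) x) * v)" for v
    by (intro Ck_on_mult Ck_on_add Suc Ck_on_const open_UNIV)
  then show ?case
    by (intro Ck_on_SucI[OF open_UNIV flat_has_derivative[unfolded has_field_derivative_def]])
       auto
qed

lemma smooth_bump_exists:
  fixes a :: "'u::euclidean_space"
  assumes "r > 0"
  obtains B where "smooth_on UNIV B" "B a > (0::real)" "\<And>z. z \<notin> ball a r \<Longrightarrow> B z = 0"
proof
  \<comment> \<open>The argument r^2 - |z - a|^2 is positive exactly inside the ball; the squared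
    norm is smooth at the centre too.\<close>
  let ?B = "\<lambda>z. flat 0 (r\<^sup>2 + - 1 * ((z + - a) \<bullet> (z + - a)))"
  have lin: "smooth_on UNIV (\<lambda>z::'u. z + - a)"
    by (intro smooth_on_add smooth_on_bounded_linear bounded_linear_ident smooth_on_const open_UNIV)
  show "smooth_on UNIV ?B"
  proof (rule smooth_on_compose[where T=UNIV and f="flat 0"])
    show "smooth_on UNIV (flat 0)" by (simp add: smooth_on_def Ck_on_flat)
    show "smooth_on UNIV (\<lambda>z. r\<^sup>2 + - 1 * ((z + - a) \<bullet> (z + - a)))"
      by (intro smooth_on_add smooth_on_mult smooth_on_const lin open_UNIV
          smooth_on_bilinear[OF bounded_bilinear_inner])
  qed auto
  show "?B a > 0" using assms by (simp add: flat_def)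
  show "?B z = 0" if "z \<notin> ball a r" for z
  proof -
    have "r \<le> norm (z - a)" using that by (simp add: dist_norm norm_minus_commute)
    then have "r\<^sup>2 \<le> (norm (z - a))\<^sup>2" using assms by (simp add: power_mono)
    then show ?thesis by (simp add: flat_def power2_norm_eq_inner)
  qed
qed

section \<open>Smooth functions and tangent vectors\<close>

lemma scaleR_fun_apply [simp]: "(c *\<^sub>R f) x = c *\<^sub>R f x"
  by (simp add: scaleR_fun_def)

lemma sum_fun_apply: "(\<Sum>i\<in>I. F i) x = (\<Sum>i\<in>I. F i x)"
  by (induction I rule: infinite_finite_induct) auto

lemma linear_over_sum:
  assumes "linear_over T F" "subspace T" "\<And>i. i \<in> I \<Longrightarrow> v i \<in> T"
  shows "F (\<Sum>i\<in>I. c i *\<^sub>R v i) = (\<Sum>i\<in>I. c i *\<^sub>R F (v i))"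
proof -
  have "F 0 = 0"
    using assms(1) subspace_0[OF assms(2)] unfolding linear_over_def by (metis scale_zero_left)
  then show ?thesis using assms(3)
  proof (induction I rule: infinite_finite_induct)
    case (insert i I)
    have "(\<Sum>i\<in>I. c i *\<^sub>R v i) \<in> T" "c i *\<^sub>R v i \<in> T"
      using insert.prems by (auto intro!: subspace_sum subspace_scale assms(2))
    then show ?case using insert assms(1) by (simp add: linear_over_def)
  qed auto
qed

text \<open>The vector with components \<open>w\<close> in one chart, with the same default 0 on
  non-smooth functions as in \<open>tangent_space\<close>, so that it is literally a member of
  it.\<close>

definition chart_tangent ::
    "('a, 'k::finite) atlas \<Rightarrow> 'a set \<Rightarrow> ('a \<Rightarrow> real ^ 'k) \<Rightarrow> 'a \<Rightarrow> real ^ 'k \<Rightarrow> 'a tangent" where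
  "chart_tangent A U x p w =
     (\<lambda>f. if f \<in> smooth_functions A then frechet_derivative (\<lambda>z. f (inv_into U x z)) (at (x p)) w else 0)"

definition extend_zero :: "'a set \<Rightarrow> ('a \<Rightarrow> 'c) \<Rightarrow> ('c \<Rightarrow> real) \<Rightarrow> 'a \<Rightarrow> real" where
  "extend_zero U x F q = (if q \<in> U then F (x q) else 0)"

text \<open>A global substitute for coordinates. The identity is demanded at every point, also where
  \<open>\<beta>\<close> vanishes, so that it can be differentiated. The fields need not be
  independent, and the index type may exceed the dimension.\<close>

definition dual_frame ::
    "('a, 'k::finite) atlas \<Rightarrow> ('a \<Rightarrow> real) \<Rightarrow> ('i::finite \<Rightarrow> 'a \<Rightarrow> real) \<Rightarrow> ('i \<Rightarrow> 'a field) \<Rightarrow> bool" where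
  "dual_frame A \<beta> u E \<longleftrightarrow>
     \<beta> \<in> smooth_functions A \<and> (\<forall>j. u j \<in> smooth_functions A) \<and> (\<forall>j. E j \<in> vector_fields A) \<and>
     (\<forall>q. \<forall>v\<in>tangent_space A q. \<beta> q *\<^sub>R v = (\<Sum>j\<in>UNIV. v (u j) *\<^sub>R E j q))"

lemma dual_frameD:
  assumes "dual_frame A \<beta> u E"
  shows "\<beta> \<in> smooth_functions A" "u j \<in> smooth_functions A" "E j \<in> vector_fields A"
    and "v \<in> tangent_space A q \<Longrightarrow> \<beta> q *\<^sub>R v = (\<Sum>j\<in>UNIV. v (u j) *\<^sub>R E j q)"
  using assms by (simp_all add: dual_frame_def)

section \<open>Charts, smooth functions and tangent spaces of a manifold\<close>

locale manifold =
  fixes A :: "('a::{t2_space, second_countable_topology}, 'k::finite) atlas"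
  assumes smooth_manifold: "smooth_manifold A"
begin

lemma chart_at: obtains U x where "(U, x) \<in> A" "p \<in> U"
proof -
  have "p \<in> (\<Union>(U, x)\<in>A. U)"
    using smooth_manifold by (simp add: smooth_manifold_def)
  then show thesis using that by auto
qed

context
  fixes U :: "'a set" and x :: "'a \<Rightarrow> real ^ 'k"
  assumes chart: "(U, x) \<in> A"
begin

lemma chart_open: "open U" "open (x ` U)"
  and chart_inv_continuous: "continuous_on (x ` U) (inv_into U x)"
  and chart_inv: "p \<in> U \<Longrightarrow> inv_into U x (x p) = p"
proof -
  have *: "open U" "open (x ` U)" "homeomorphism U (x ` U) x (inv_into U x)"
    using smooth_manifold chart unfolding smooth_manifold_def by blast+
  then show "open U" "open (x ` U)" by simp_all
  show "continuous_on (x ` U) (inv_into U x)"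
    using *(3) by (simp add: homeomorphism_def)
  show "inv_into U x (x p) = p" if "p \<in> U"
    using *(3) that by (simp add: homeomorphism_def)
qed

lemma chart_image_open:
  assumes "open W"
  shows "open (x ` (U \<inter> W))"
proof -
  have "x ` (U \<inter> W) = x ` U \<inter> inv_into U x -` W"
    using chart_inv by (auto simp: image_iff)
  also have "open \<dots>"
    using chart_open(2) chart_inv_continuous assms
    by (metis Int_commute continuous_on_open_vimage)
  finally show ?thesis .
qed

lemma chart_transition_smooth:
  assumes "(V, y) \<in> A"
  shows "smooth_on (x ` (U \<inter> V)) (\<lambda>z. y (inv_into U x z))"
  using smooth_manifold chart assms unfolding smooth_manifold_def o_def by fast

lemma smooth_function_chart: "f \<in> smooth_functions A \<Longrightarrow> smooth_on (x ` U) (\<lambda>z. f (inv_into U x z))"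
  using chart unfolding smooth_functions_def o_def by auto

lemma smooth_function_chart_derivative:
  assumes "f \<in> smooth_functions A" "p \<in> U"
  shows "((\<lambda>z. f (inv_into U x z)) has_derivative frechet_derivative (\<lambda>z. f (inv_into U x z)) (at (x p))) (at (x p))"
  using smooth_on_has_derivative[OF smooth_function_chart[OF assms(1)] chart_open(2)] assms(2) by blast

end

lemma smooth_functionI:
  "(\<And>U x. (U, x) \<in> A \<Longrightarrow> smooth_on (x ` U) (\<lambda>z. f (inv_into U x z))) \<Longrightarrow> f \<in> smooth_functions A"
  unfolding smooth_functions_def o_def by auto

lemma smooth_const [simp]: "(\<lambda>q. c) \<in> smooth_functions A"
  by (rule smooth_functionI) simp

lemma smooth_add:
  "f \<in> smooth_functions A \<Longrightarrow> g \<in> smooth_functions A \<Longrightarrow> (\<lambda>q. f q + g q) \<in> smooth_functions A"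
  by (rule smooth_functionI) (intro smooth_on_add smooth_function_chart chart_open(2))

lemma smooth_mult:
  "f \<in> smooth_functions A \<Longrightarrow> g \<in> smooth_functions A \<Longrightarrow> (\<lambda>q. f q * g q) \<in> smooth_functions A"
  by (rule smooth_functionI) (intro smooth_on_mult smooth_function_chart chart_open(2))

lemma smooth_diff:
  "f \<in> smooth_functions A \<Longrightarrow> g \<in> smooth_functions A \<Longrightarrow> (\<lambda>q. f q - g q) \<in> smooth_functions A"
  using smooth_add[of f "\<lambda>q. - 1 * g q"] smooth_mult[of "\<lambda>q. - 1" g] by simp

lemma smooth_sum:
  "(\<And>i. i \<in> I \<Longrightarrow> f i \<in> smooth_functions A) \<Longrightarrow> (\<lambda>q. \<Sum>i\<in>I. f i q) \<in> smooth_functions A"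
  by (induction I rule: infinite_finite_induct) (auto intro: smooth_add)

lemma smooth_prod:
  "(\<And>i. i \<in> I \<Longrightarrow> f i \<in> smooth_functions A) \<Longrightarrow> (\<lambda>q. \<Prod>i\<in>I. f i q) \<in> smooth_functions A"
  by (induction I rule: infinite_finite_induct) (auto intro: smooth_mult)

lemma smooth_power: "f \<in> smooth_functions A \<Longrightarrow> (\<lambda>q. f q ^ n) \<in> smooth_functions A"
  by (induction n) (auto intro: smooth_mult)

text \<open>Smoothness is local, and near p the function f is the product of \<open>inverse\<close>
  of \<psi> with \<psi> f. This converts identities that carry a factor into smoothness without
  it.\<close>

lemma smooth_divide:
  assumes "\<And>p. \<exists>\<psi>\<in>smooth_functions A. \<psi> p \<noteq> 0 \<and> (\<lambda>q. \<psi> q * f q) \<in> smooth_functions A"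
  shows "f \<in> smooth_functions A"
proof (rule smooth_functionI)
  fix U x assume chart: "(U, x) \<in> A"
  show "smooth_on (x ` U) (\<lambda>z. f (inv_into U x z))"
  proof (rule smooth_on_local[OF _ chart_open(2)[OF chart]])
    fix z assume z: "z \<in> x ` U"
    obtain \<psi> where \<psi>: "\<psi> \<in> smooth_functions A" "\<psi> (inv_into U x z) \<noteq> 0"
      "(\<lambda>q. \<psi> q * f q) \<in> smooth_functions A"
      using assms by blast
    let ?T = "x ` U \<inter> (\<lambda>z. \<psi> (inv_into U x z)) -` (- {0})"
    have "open ?T"
      using smooth_on_imp_continuous_on[OF smooth_function_chart[OF chart \<psi>(1)]] chart_open(2)[OF chart]
      by (metis Int_commute continuous_on_open_vimage open_Compl closed_singleton)
    moreover have "smooth_on ?T (\<lambda>z. f (inv_into U x z))"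
    proof (rule smooth_on_cong[OF \<open>open ?T\<close>])
      show "smooth_on ?T (\<lambda>z. inverse (\<psi> (inv_into U x z)) * (\<psi> (inv_into U x z) * f (inv_into U x z)))"
      proof (rule smooth_on_mult[OF \<open>open ?T\<close> smooth_on_inverse[OF \<open>open ?T\<close>]])
        show "smooth_on ?T (\<lambda>z. \<psi> (inv_into U x z))"
          using smooth_on_subset[OF smooth_function_chart[OF chart \<psi>(1)]] by blast
        show "smooth_on ?T (\<lambda>z. \<psi> (inv_into U x z) * f (inv_into U x z))"
          using smooth_on_subset[OF smooth_function_chart[OF chart \<psi>(3)]] by blast
      qed auto
    qed auto
    ultimately show "\<exists>T. open T \<and> z \<in> T \<and> T \<subseteq> x ` U \<and> smooth_on T (\<lambda>z. f (inv_into U x z))"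
      using z \<psi>(2) by (intro exI[of _ ?T]) auto
  qed
qed

text \<open>Two open sets cover the manifold: U, where the function is F in coordinates, and the
  complement of the preimage of K, where it is 0. The complement is open because a compact set is
  closed in a Hausdorff space.\<close>

lemma extend_zero_smooth:
  assumes chart: "(U, x) \<in> A" and F: "smooth_on (x ` U) F"
    and K: "compact K" "K \<subseteq> x ` U" "\<And>z. z \<notin> K \<Longrightarrow> F z = 0"
  shows "extend_zero U x F \<in> smooth_functions A"
proof (rule smooth_functionI)
  fix V y assume chart': "(V, y) \<in> A"
  let ?K = "inv_into U x ` K"
  have "compact ?K"
    using compact_continuous_image continuous_on_subset chart_inv_continuous[OF chart] K by blast
  then have "open (- ?K)" by (simp add: compact_imp_closed open_Compl)
  show "smooth_on (y ` V) (\<lambda>z. extend_zero U x F (inv_into V y z))"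
  proof (rule smooth_on_local[OF _ chart_open(2)[OF chart']])
    fix z assume z: "z \<in> y ` V"
    show "\<exists>T. open T \<and> z \<in> T \<and> T \<subseteq> y ` V \<and> smooth_on T (\<lambda>z. extend_zero U x F (inv_into V y z))"
    proof (cases "inv_into V y z \<in> U")
      case True
      let ?T = "y ` (V \<inter> U)"
      have "open ?T" by (rule chart_image_open[OF chart' chart_open(1)[OF chart]])
      moreover have "smooth_on ?T (\<lambda>z. extend_zero U x F (inv_into V y z))"
      proof (rule smooth_on_cong[OF \<open>open ?T\<close>])
        show "smooth_on ?T (\<lambda>z. F (x (inv_into V y z)))"
          by (rule smooth_on_compose[OF \<open>open ?T\<close> chart_open(2)[OF chart] _ F
                chart_transition_smooth[OF chart' chart]])
             (auto simp: chart_inv[OF chart'])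
      qed (auto simp: extend_zero_def chart_inv[OF chart'])
      ultimately show ?thesis
        using z True by (intro exI[of _ ?T]) (auto simp: chart_inv[OF chart'])
    next
      case False
      let ?T = "y ` (V \<inter> - ?K)"
      have "open ?T" by (rule chart_image_open[OF chart' \<open>open (- ?K)\<close>])
      moreover have "smooth_on ?T (\<lambda>z. extend_zero U x F (inv_into V y z))"
      proof (rule smooth_on_cong[OF \<open>open ?T\<close> _ smooth_on_const[of _ 0]])
        fix z assume "z \<in> ?T"
        then obtain q where q: "z = y q" "q \<in> V" "q \<notin> ?K" by auto
        have "x q \<notin> K" if "q \<in> U" using q(3) chart_inv[OF chart that] by (metis imageI)
        then show "0 = extend_zero U x F (inv_into V y z)"
          using q K(3) by (auto simp: extend_zero_def chart_inv[OF chart'])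
      qed
      moreover have "?K \<subseteq> U"
        using K(2) chart_inv[OF chart] by auto
      moreover have "z \<in> ?T"
      proof -
        obtain q where "z = y q" "q \<in> V" using z by blast
        then show ?thesis using False \<open>?K \<subseteq> U\<close> chart_inv[OF chart'] by blast
      qed
      ultimately show ?thesis by (intro exI[of _ ?T]) auto
    qed
  qed
qed

text \<open>The chain rule: components transform by the derivative of the change of
  coordinates.\<close>

lemma chart_tangent_transition:
  assumes chart: "(U, x) \<in> A" "p \<in> U" and chart': "(V, y) \<in> A" "p \<in> V"
  shows "chart_tangent A U x p w = chart_tangent A V y p (frechet_derivative (\<lambda>z. y (inv_into U x z)) (at (x p)) w)"
proof
  fix f
  let ?S = "x ` (U \<inter> V)" and ?\<tau> = "\<lambda>z. y (inv_into U x z)"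
  have S: "open ?S" "x p \<in> ?S"
    using chart_image_open[OF chart(1) chart_open(1)[OF chart'(1)]] chart(2) chart'(2) by auto
  show "chart_tangent A U x p w f = chart_tangent A V y p (frechet_derivative ?\<tau> (at (x p)) w) f"
  proof (cases "f \<in> smooth_functions A")
    case True
    have \<tau>: "(?\<tau> has_derivative frechet_derivative ?\<tau> (at (x p))) (at (x p))"
      by (rule smooth_on_has_derivative[OF chart_transition_smooth[OF chart(1) chart'(1)] S])
    have [simp]: "?\<tau> (x p) = y p" by (simp add: chart_inv[OF chart])
    have "((\<lambda>z. f (inv_into V y (?\<tau> z))) has_derivative
        (\<lambda>w. frechet_derivative (\<lambda>z. f (inv_into V y z)) (at (y p)) (frechet_derivative ?\<tau> (at (x p)) w))) (at (x p))"
      by (rule has_derivative_compose[OF \<tau>])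
         (simp add: smooth_function_chart_derivative[OF chart'(1) True chart'(2), simplified])
    then have "((\<lambda>z. f (inv_into U x z)) has_derivative
        (\<lambda>w. frechet_derivative (\<lambda>z. f (inv_into V y z)) (at (y p)) (frechet_derivative ?\<tau> (at (x p)) w))) (at (x p))"
      by (rule has_derivative_transform_within_open[OF _ S])
         (auto simp: chart_inv[OF chart(1)] chart_inv[OF chart'(1)])
    from fun_cong[OF frechet_derivative_at[OF this], of w] show ?thesis
      by (simp add: True chart_tangent_def)
  qed (simp add: chart_tangent_def)
qed

text \<open>\<open>tangent_space\<close> collects vectors from all charts around p; moving them into
  one chart is what makes sums of vectors from different charts tangent again.\<close>

lemma tangent_space_chart:
  assumes "(U, x) \<in> A" "p \<in> U"
  shows "tangent_space A p = range (chart_tangent A U x p)"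
proof -
  have "tangent_space A p = {chart_tangent A V y p w | V y w. (V, y) \<in> A \<and> p \<in> V}"
    unfolding tangent_space_def chart_tangent_def o_def by simp
  also have "\<dots> = range (chart_tangent A U x p)"
  proof (intro equalityI subsetI)
    fix v assume "v \<in> {chart_tangent A V y p w | V y w. (V, y) \<in> A \<and> p \<in> V}"
    then obtain V y w where "v = chart_tangent A V y p w" "(V, y) \<in> A" "p \<in> V" by blast
    then show "v \<in> range (chart_tangent A U x p)"
      using chart_tangent_transition[OF _ _ assms] by simp
  qed (use assms in blast)
  finally show ?thesis .
qed

lemma chart_tangent_linear:
  assumes "(U, x) \<in> A" "p \<in> U"
  shows "linear (chart_tangent A U x p)"
proof -
  have "linear (frechet_derivative (\<lambda>z. f (inv_into U x z)) (at (x p)))" if "f \<in> smooth_functions A" for f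
    using smooth_function_chart_derivative[OF assms(1) that assms(2)] has_derivative_linear by blast
  then show ?thesis
    by (intro linearI) (auto simp: chart_tangent_def fun_eq_iff linear_add linear_cmul)
qed

lemma subspace_tangent_space: "subspace (tangent_space A p)"
proof -
  obtain U x where "(U, x) \<in> A" "p \<in> U" by (rule chart_at)
  then show ?thesis
    by (simp add: tangent_space_chart chart_tangent_linear linear_subspace_image)
qed

lemma tangent_add: "u \<in> tangent_space A p \<Longrightarrow> v \<in> tangent_space A p \<Longrightarrow> u + v \<in> tangent_space A p"
  and tangent_scale: "u \<in> tangent_space A p \<Longrightarrow> c *\<^sub>R u \<in> tangent_space A p"
  and tangent_diff: "u \<in> tangent_space A p \<Longrightarrow> v \<in> tangent_space A p \<Longrightarrow> u - v \<in> tangent_space A p"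
  and tangent_sum: "(\<And>i. i \<in> I \<Longrightarrow> F i \<in> tangent_space A p) \<Longrightarrow> (\<Sum>i\<in>I. F i) \<in> tangent_space A p"
  and tangent_0 [simp]: "0 \<in> tangent_space A p"
  using subspace_tangent_space
  by (auto intro: subspace_add subspace_scale subspace_diff subspace_sum subspace_0)

lemma tangent_derivation:
  assumes "v \<in> tangent_space A p" "f \<in> smooth_functions A" "g \<in> smooth_functions A"
  shows tangent_plus: "v (\<lambda>q. f q + g q) = v f + v g"
    and tangent_times: "v (\<lambda>q. f q * g q) = f p * v g + g p * v f"
proof -
  obtain U x where c: "(U, x) \<in> A" "p \<in> U" by (rule chart_at)
  obtain w where v: "v = chart_tangent A U x p w"
    using assms(1) tangent_space_chart[OF c] by auto
  let ?f = "\<lambda>z. f (inv_into U x z)" and ?g = "\<lambda>z. g (inv_into U x z)"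
  note d = smooth_function_chart_derivative[OF c(1) _ c(2)]
  have "((\<lambda>z. ?f z + ?g z) has_derivative (\<lambda>w. frechet_derivative ?f (at (x p)) w +
      frechet_derivative ?g (at (x p)) w)) (at (x p))"
    by (intro has_derivative_add d assms)
  from fun_cong[OF frechet_derivative_at[OF this], of w] show "v (\<lambda>q. f q + g q) = v f + v g"
    using assms smooth_add by (simp add: v chart_tangent_def)
  have "((\<lambda>z. ?f z * ?g z) has_derivative (\<lambda>w. ?f (x p) * frechet_derivative ?g (at (x p)) w +
      frechet_derivative ?f (at (x p)) w * ?g (x p))) (at (x p))"
    by (intro has_derivative_mult d assms)
  from fun_cong[OF frechet_derivative_at[OF this, symmetric], of w] show "v (\<lambda>q. f q * g q) = f p * v g + g p * v f"
    using assms smooth_mult by (simp add: v chart_tangent_def chart_inv[OF c] mult.commute)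
qed

lemma tangent_const: "v \<in> tangent_space A p \<Longrightarrow> v (\<lambda>q. c) = 0"
proof -
  assume "v \<in> tangent_space A p"
  moreover obtain U x where "(U, x) \<in> A" "p \<in> U" by (rule chart_at)
  ultimately show ?thesis
    by (auto simp: tangent_space_chart chart_tangent_def frechet_derivative_const)
qed

lemma chart_tangent_extend_zero:
  assumes "(U, x) \<in> A" "p \<in> U" "extend_zero U x F \<in> smooth_functions A"
    and F: "(F has_derivative F') (at (x p))"
  shows "chart_tangent A U x p w (extend_zero U x F) = F' w"
proof -
  have "((\<lambda>z. extend_zero U x F (inv_into U x z)) has_derivative F') (at (x p))"
    by (rule has_derivative_transform_within_open[OF F chart_open(2)[OF assms(1)]])
       (use assms in \<open>auto simp: extend_zero_def chart_inv[OF assms(1)]\<close>)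
  from fun_cong[OF frechet_derivative_at[OF this], of w] show ?thesis
    by (simp add: assms(3) chart_tangent_def)
qed

section \<open>Global frames and extension of tangent vectors\<close>

lemma vector_fieldI:
  "(\<And>p. X p \<in> tangent_space A p) \<Longrightarrow> (\<And>f. f \<in> smooth_functions A \<Longrightarrow> (\<lambda>p. X p f) \<in> smooth_functions A)
    \<Longrightarrow> X \<in> vector_fields A"
  by (simp add: vector_fields_def fields_along_def)

text \<open>
  \<open>b\<close> is a bump function in a chart around \<open>p\<close>, \<open>u j\<close> the \<open>j\<close>-th coordinate times \<open>b\<close> and \<open>E j\<close>
  the \<open>j\<close>-th coordinate field times \<open>b\<close>; thus \<open>b q * v (u j) - u j q * v b\<close> is
  \<open>(b q)\<^sup>2\<close> times the \<open>j\<close>-th component of \<open>v\<close>.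
\<close>

lemma coordinate_frame:
  fixes p :: 'a
  obtains b :: "'a \<Rightarrow> real" and u :: "'k \<Rightarrow> 'a \<Rightarrow> real" and E :: "'k \<Rightarrow> 'a field"
  where "b \<in> smooth_functions A" "b p \<noteq> 0" "\<And>j. u j \<in> smooth_functions A" "\<And>j. E j \<in> vector_fields A"
    and "\<And>q v. v \<in> tangent_space A q \<Longrightarrow>
      (b q) ^ 3 *\<^sub>R v = (\<Sum>j\<in>UNIV. (b q * v (u j) - u j q * v b) *\<^sub>R E j q)"
    and "\<And>q i j. b q * E i q (u j) - u j q * E i q b = (if i = j then (b q) ^ 3 else 0)"
proof -
  obtain U x where c: "(U, x) \<in> A" "p \<in> U" by (rule chart_at)
  obtain r where r: "r > 0" "cball (x p) r \<subseteq> x ` U"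
    using chart_open(2)[OF c(1)] c(2) by (metis imageI open_contains_cball)
  obtain B where B: "smooth_on UNIV B" "B (x p) > (0::real)" "\<And>z. z \<notin> ball (x p) r \<Longrightarrow> B z = 0"
    using smooth_bump_exists[OF r(1)] by metis
  have B0: "B z = 0" if "z \<notin> cball (x p) r" for z
    using B(3)[of z] that ball_subset_cball by blast
  note ext = extend_zero_smooth[OF c(1) _ compact_cball r(2)]
  define b where "b = extend_zero U x B"
  define u where "u j = extend_zero U x (\<lambda>z. B z * z $ j)" for j
  define E where "E j q = (if q \<in> U then B (x q) *\<^sub>R chart_tangent A U x q (axis j 1) else 0)" for j q
  have b: "b \<in> smooth_functions A"
    unfolding b_def by (rule ext[OF smooth_on_subset[OF B(1)] B0]) auto
  have u: "u j \<in> smooth_functions A" for j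
    unfolding u_def
  proof (rule ext)
    show "smooth_on (x ` U) (\<lambda>z. B z * z $ j)"
      by (intro smooth_on_mult chart_open[OF c(1)] smooth_on_subset[OF B(1)] smooth_on_bounded_linear
          bounded_linear_vec_nth) auto
  qed (simp add: B0)
  have E: "E j \<in> vector_fields A" for j
  proof (rule vector_fieldI)
    fix q
    show "E j q \<in> tangent_space A q"
    proof (cases "q \<in> U")
      case True
      then have "chart_tangent A U x q (axis j 1) \<in> tangent_space A q"
        using tangent_space_chart[OF c(1)] by simp
      then show ?thesis using True by (simp add: E_def tangent_scale)
    qed (simp add: E_def)
  next
    fix f assume f: "f \<in> smooth_functions A"
    have "(\<lambda>q. E j q f) = extend_zero U x (\<lambda>z. B z * frechet_derivative (\<lambda>z. f (inv_into U x z)) (at z) (axis j 1))"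
      using f by (auto simp: E_def extend_zero_def chart_tangent_def fun_eq_iff)
    also have "\<dots> \<in> smooth_functions A"
      by (rule ext, intro smooth_on_mult chart_open[OF c(1)] smooth_on_subset[OF B(1)]
          smooth_on_derivative smooth_function_chart[OF c(1) f]) (auto simp: B0)
    finally show "(\<lambda>q. E j q f) \<in> smooth_functions A" .
  qed
  have comp: "b q * v (u j) - u j q * v b = (B (x q))\<^sup>2 * w $ j"
    if q: "q \<in> U" and v: "v = chart_tangent A U x q w" for q v w j
  proof -
    let ?B' = "frechet_derivative B (at (x q))"
    have dB: "(B has_derivative ?B') (at (x q))"
      by (rule smooth_on_has_derivative[OF B(1)]) auto
    have "((\<lambda>z. B z * z $ j) has_derivative (\<lambda>w. B (x q) * w $ j + ?B' w * x q $ j)) (at (x q))"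
      by (intro has_derivative_mult dB bounded_linear_imp_has_derivative bounded_linear_vec_nth)
    then have "v (u j) = B (x q) * w $ j + ?B' w * x q $ j"
      unfolding v u_def by (rule chart_tangent_extend_zero[OF c(1) q u[unfolded u_def]])
    moreover have "v b = ?B' w"
      unfolding v b_def by (rule chart_tangent_extend_zero[OF c(1) q b[unfolded b_def] dB])
    moreover have "b q = B (x q)" "u j q = B (x q) * x q $ j"
      using q by (auto simp: b_def u_def extend_zero_def)
    ultimately show ?thesis by (simp add: algebra_simps power2_eq_square)
  qed
  show thesis
  proof
    show "b p \<noteq> 0" using B(2) c(2) by (simp add: b_def extend_zero_def)
    fix q
    show "(b q) ^ 3 *\<^sub>R v = (\<Sum>j\<in>UNIV. (b q * v (u j) - u j q * v b) *\<^sub>R E j q)"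
      if v: "v \<in> tangent_space A q" for v
    proof (cases "q \<in> U")
      case True
      then obtain w where w: "v = chart_tangent A U x q w"
        using v tangent_space_chart[OF c(1)] by auto
      note lin = chart_tangent_linear[OF c(1) True]
      have "(\<Sum>j\<in>UNIV. (b q * v (u j) - u j q * v b) *\<^sub>R E j q) =
          (\<Sum>j\<in>UNIV. (B (x q)) ^ 3 *\<^sub>R w $ j *\<^sub>R chart_tangent A U x q (axis j 1))"
        unfolding comp[OF True w] using True by (simp add: E_def power2_eq_square power3_eq_cube mult_ac)
      also have "\<dots> = (B (x q)) ^ 3 *\<^sub>R chart_tangent A U x q (\<Sum>j\<in>UNIV. w $ j *\<^sub>R axis j 1)"
        by (simp add: linear_sum[OF lin] linear_cmul[OF lin] scaleR_sum_right)
      also have "(\<Sum>j\<in>UNIV. w $ j *\<^sub>R axis j 1) = w"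
        using basis_expansion[of w] by (simp add: scalar_mult_eq_scaleR)
      finally have "(\<Sum>j\<in>UNIV. (b q * v (u j) - u j q * v b) *\<^sub>R E j q) = B (x q) ^ 3 *\<^sub>R v"
        by (simp only: w)
      then show ?thesis
        using True by (simp add: b_def extend_zero_def[of _ _ _ q])
    qed (auto simp: E_def b_def extend_zero_def)
    show "b q * E i q (u j) - u j q * E i q b = (if i = j then (b q) ^ 3 else 0)" for i j
    proof (cases "q \<in> U")
      case True
      have "E i q = chart_tangent A U x q (B (x q) *\<^sub>R axis i 1)"
        using True by (simp add: E_def linear_cmul[OF chart_tangent_linear[OF c(1) True]])
      from comp[OF True this] show ?thesis
        using True by (auto simp: b_def extend_zero_def axis_def power2_eq_square power3_eq_cube)
    qed (auto simp: E_def b_def extend_zero_def)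
  qed (use b u E in auto)
qed

lemma dual_frame_exists:
  fixes p :: 'a
  obtains \<beta> :: "'a \<Rightarrow> real" and u :: "'k option \<Rightarrow> 'a \<Rightarrow> real" and E :: "'k option \<Rightarrow> 'a field"
  where "dual_frame A \<beta> u E" "\<beta> p \<noteq> 0"
proof -
  obtain b :: "'a \<Rightarrow> real" and u :: "'k \<Rightarrow> 'a \<Rightarrow> real" and E :: "'k \<Rightarrow> 'a field"
    where b: "b \<in> smooth_functions A" "b p \<noteq> 0" and u: "\<And>j. u j \<in> smooth_functions A"
      and E: "\<And>j. E j \<in> vector_fields A"
      and frame: "\<And>q v. v \<in> tangent_space A q \<Longrightarrow>
        (b q) ^ 3 *\<^sub>R v = (\<Sum>j\<in>UNIV. (b q * v (u j) - u j q * v b) *\<^sub>R E j q)"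
      and "\<And>q i j. b q * E i q (u j) - u j q * E i q b = (if i = j then (b q) ^ 3 else 0)"
    by (rule coordinate_frame[of p]) (rule that)
  \<comment> \<open>Cutting off a coordinate spoils duality: v(b x_j) = b v(x_j) + x_j v(b). The
    extra index \<open>None\<close> pairs b itself with minus the sum of the u_j E_j, which cancels
    the second term.\<close>
  let ?u = "\<lambda>j. case j of None \<Rightarrow> b | Some j \<Rightarrow> u j"
  let ?E = "\<lambda>j q. case j of None \<Rightarrow> - (\<Sum>j\<in>UNIV. u j q *\<^sub>R E j q) | Some j \<Rightarrow> b q *\<^sub>R E j q"
  have Et: "E j q \<in> tangent_space A q" and Es: "f \<in> smooth_functions A \<Longrightarrow> (\<lambda>q. E j q f) \<in> smooth_functions A"
    for j q f using E[of j] by (auto simp: vector_fields_def fields_along_def)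
  have "dual_frame A (\<lambda>q. b q ^ 3) ?u ?E"
    unfolding dual_frame_def
  proof (intro conjI allI ballI)
    show "(\<lambda>q. b q ^ 3) \<in> smooth_functions A" by (rule smooth_power[OF b(1)])
    show "?u j \<in> smooth_functions A" for j using b u by (auto split: option.split)
    show "?E j \<in> vector_fields A" for j
    proof (rule vector_fieldI)
      show "?E j q \<in> tangent_space A q" for q
        by (cases j) (auto intro!: subspace_neg[OF subspace_tangent_space] tangent_sum tangent_scale Et)
      show "(\<lambda>q. ?E j q f) \<in> smooth_functions A" if "f \<in> smooth_functions A" for f
      proof (cases j)
        case None
        have "(\<lambda>q. 0 - (\<Sum>j\<in>UNIV. u j q * E j q f)) \<in> smooth_functions A"
          by (intro smooth_diff smooth_sum smooth_mult smooth_const u Es that)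
        then show ?thesis using None by (simp add: sum_fun_apply)
      qed (auto intro!: smooth_mult b Es that)
    qed
    fix q v assume v: "v \<in> tangent_space A q"
    have "(\<Sum>j\<in>UNIV. v (?u j) *\<^sub>R ?E j q) =
        v b *\<^sub>R - (\<Sum>j\<in>UNIV. u j q *\<^sub>R E j q) + (\<Sum>j\<in>UNIV. v (u j) *\<^sub>R b q *\<^sub>R E j q)"
      by (simp add: UNIV_option_conv sum.reindex)
    also have "\<dots> = (b q) ^ 3 *\<^sub>R v"
      unfolding frame[OF v]
      by (simp add: scaleR_sum_right sum_negf sum.distrib[symmetric] sum_subtractf[symmetric] algebra_simps)
    finally show "(b q) ^ 3 *\<^sub>R v = (\<Sum>j\<in>UNIV. v (?u j) *\<^sub>R ?E j q)" by simp
  qed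
  then show thesis by (rule that) (simp add: b(2))
qed

lemma tangent_sum_apply:
  assumes "v \<in> tangent_space A p" "\<And>i. i \<in> I \<Longrightarrow> f i \<in> smooth_functions A"
  shows "v (\<lambda>q. \<Sum>i\<in>I. f i q) = (\<Sum>i\<in>I. v (f i))"
  using assms(2)
proof (induction I rule: infinite_finite_induct)
  case (insert i I)
  then show ?case using tangent_plus[OF assms(1), of "f i" "\<lambda>q. \<Sum>i\<in>I. f i q"] by (simp add: smooth_sum)
qed (auto simp: tangent_const[OF assms(1)])

lemma tangent_not_smooth: "v \<in> tangent_space A p \<Longrightarrow> f \<notin> smooth_functions A \<Longrightarrow> v f = 0"
  unfolding tangent_space_def by auto

lemma vector_field_tangent: "X \<in> vector_fields A \<Longrightarrow> X p \<in> tangent_space A p"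
  and vector_field_smooth:
    "X \<in> vector_fields A \<Longrightarrow> f \<in> smooth_functions A \<Longrightarrow> (\<lambda>p. X p f) \<in> smooth_functions A"
  by (simp_all add: vector_fields_def fields_along_def)

lemma vector_field_add:
  "X \<in> vector_fields A \<Longrightarrow> Y \<in> vector_fields A \<Longrightarrow> (\<lambda>p. X p + Y p) \<in> vector_fields A"
  by (rule vector_fieldI) (auto intro: tangent_add smooth_add vector_field_tangent vector_field_smooth)

lemma vector_field_diff:
  "X \<in> vector_fields A \<Longrightarrow> Y \<in> vector_fields A \<Longrightarrow> (\<lambda>p. X p - Y p) \<in> vector_fields A"
  by (rule vector_fieldI) (auto intro: tangent_diff smooth_diff vector_field_tangent vector_field_smooth)

lemma vector_field_scale:
  "a \<in> smooth_functions A \<Longrightarrow> X \<in> vector_fields A \<Longrightarrow> (\<lambda>p. a p *\<^sub>R X p) \<in> vector_fields A"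
  by (rule vector_fieldI) (auto intro: tangent_scale smooth_mult vector_field_tangent vector_field_smooth)

lemma vector_field_through:
  assumes "v \<in> tangent_space A p"
  obtains X where "X \<in> vector_fields A" "X p = v"
proof -
  obtain \<beta> :: "'a \<Rightarrow> real" and u :: "'k option \<Rightarrow> 'a \<Rightarrow> real" and E :: "'k option \<Rightarrow> 'a field"
    where F: "dual_frame A \<beta> u E" and \<beta>: "\<beta> p \<noteq> 0"
    by (rule dual_frame_exists)
  note E = dual_frameD(3)[OF F]
  \<comment> \<open>The coefficients of the frame identity are frozen at their values at p; the
    fields \<open>E j\<close> are already global.\<close>
  let ?X = "\<lambda>q. \<Sum>j\<in>UNIV. (v (u j) / \<beta> p) *\<^sub>R E j q"
  have "?X \<in> vector_fields A"
  proof (rule vector_fieldI)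
    show "?X q \<in> tangent_space A q" for q
      by (intro tangent_sum tangent_scale vector_field_tangent E)
    show "(\<lambda>q. ?X q f) \<in> smooth_functions A" if "f \<in> smooth_functions A" for f
      unfolding sum_fun_apply scaleR_fun_apply real_scaleR_def
      by (intro smooth_sum smooth_mult smooth_const vector_field_smooth[OF E] that)
  qed
  moreover have "?X p = inverse (\<beta> p) *\<^sub>R (\<Sum>j\<in>UNIV. v (u j) *\<^sub>R E j p)"
    by (simp add: scaleR_sum_right divide_inverse mult.commute)
  then have "?X p = v" using \<beta> by (simp add: dual_frameD(4)[OF F assms, symmetric])
  ultimately show thesis by (rule that)
qed

end

section \<open>Fields along a smooth map\<close>

lemma push_add: "push B \<iota> (u + v) = push B \<iota> u + push B \<iota> v"
  and push_diff: "push B \<iota> (u - v) = push B \<iota> u - push B \<iota> v"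
  and push_scale: "push B \<iota> (c *\<^sub>R v) = c *\<^sub>R push B \<iota> v"
  and push_0: "push B \<iota> 0 = 0"
  by (auto simp: push_def fun_eq_iff)

lemma push_sum: "push B \<iota> (\<Sum>i\<in>I. F i) = (\<Sum>i\<in>I. push B \<iota> (F i))"
  by (induction I rule: infinite_finite_induct) (simp_all only: sum.infinite sum.empty sum.insert push_add push_0 simp_thms)

lemma push_apply: "f \<in> smooth_functions B \<Longrightarrow> push B \<iota> v f = v (\<lambda>q. f (\<iota> q))"
  by (simp add: push_def o_def)

locale smooth_mapping = A: manifold A + B: manifold B
  for A :: "('a::{t2_space, second_countable_topology}, 'k::finite) atlas"
    and B :: "('b::{t2_space, second_countable_topology}, 'l::finite) atlas" +
  fixes \<iota> :: "'a \<Rightarrow> 'b"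
  assumes smooth_map: "smooth_map A B \<iota>"
begin

lemma local_expression:
  assumes "(U, x) \<in> A" "(V, y) \<in> B"
  shows "open (x ` (U \<inter> \<iota> -` V))"
    and "smooth_on (x ` (U \<inter> \<iota> -` V)) (\<lambda>z. y (\<iota> (inv_into U x z)))"
proof -
  have "continuous_on UNIV \<iota>" using smooth_map by (simp add: smooth_map_def)
  then have "open (\<iota> -` V)" using B.chart_open(1)[OF assms(2)] by (rule open_vimage[rotated])
  then show "open (x ` (U \<inter> \<iota> -` V))" by (rule A.chart_image_open[OF assms(1)])
  have "\<forall>(U, x)\<in>A. \<forall>(V, y)\<in>B. smooth_on (x ` (U \<inter> \<iota> -` V)) (y \<circ> \<iota> \<circ> inv_into U x)"
    using smooth_map by (simp add: smooth_map_def)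
  with assms have "smooth_on (x ` (U \<inter> \<iota> -` V)) (y \<circ> \<iota> \<circ> inv_into U x)" by fast
  then show "smooth_on (x ` (U \<inter> \<iota> -` V)) (\<lambda>z. y (\<iota> (inv_into U x z)))" by (simp add: o_def)
qed

lemma pullback_smooth:
  assumes f: "f \<in> smooth_functions B"
  shows "(\<lambda>p. f (\<iota> p)) \<in> smooth_functions A"
proof (rule A.smooth_functionI, rule smooth_on_local)
  fix U x z assume U: "(U, x) \<in> A" and z: "z \<in> x ` U"
  then obtain p where p: "p \<in> U" "z = x p" by blast
  obtain V y where V: "(V, y) \<in> B" "\<iota> p \<in> V" by (rule B.chart_at)
  let ?T = "x ` (U \<inter> \<iota> -` V)"
  note loc = local_expression[OF U V(1)]
  have "smooth_on ?T (\<lambda>z. f (inv_into V y (y (\<iota> (inv_into U x z)))))"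
    by (rule smooth_on_compose[OF loc(1) B.chart_open(2)[OF V(1)] _ B.smooth_function_chart[OF V(1) f] loc(2)])
       (auto simp: A.chart_inv[OF U])
  then have "smooth_on ?T (\<lambda>z. f (\<iota> (inv_into U x z)))"
    by (rule smooth_on_cong[OF loc(1), rotated]) (auto simp: A.chart_inv[OF U] B.chart_inv[OF V(1)])
  then show "\<exists>T. open T \<and> z \<in> T \<and> T \<subseteq> x ` U \<and> smooth_on T (\<lambda>z. f (\<iota> (inv_into U x z)))"
    using loc(1) p V(2) by (intro exI[of _ ?T]) auto
qed (rule A.chart_open(2))

lemma push_tangent:
  assumes "v \<in> tangent_space A p"
  shows "push B \<iota> v \<in> tangent_space B (\<iota> p)"
proof -
  obtain U x where U: "(U, x) \<in> A" "p \<in> U" by (rule A.chart_at)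
  obtain V y where V: "(V, y) \<in> B" "\<iota> p \<in> V" by (rule B.chart_at)
  obtain w where w: "v = chart_tangent A U x p w"
    using assms A.tangent_space_chart[OF U] by auto
  let ?\<tau> = "\<lambda>z. y (\<iota> (inv_into U x z))"
  note loc = local_expression[OF U(1) V(1)]
  have xp: "x p \<in> x ` (U \<inter> \<iota> -` V)" using U V by auto
  have \<tau>: "(?\<tau> has_derivative frechet_derivative ?\<tau> (at (x p))) (at (x p))"
    by (rule smooth_on_has_derivative[OF loc(2) loc(1) xp])
  have "push B \<iota> v = chart_tangent B V y (\<iota> p) (frechet_derivative ?\<tau> (at (x p)) w)"
  proof
    fix f
    show "push B \<iota> v f = chart_tangent B V y (\<iota> p) (frechet_derivative ?\<tau> (at (x p)) w) f"
    proof (cases "f \<in> smooth_functions B")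
      case True
      have [simp]: "?\<tau> (x p) = y (\<iota> p)" by (simp add: A.chart_inv[OF U])
      have "((\<lambda>z. f (inv_into V y (?\<tau> z))) has_derivative
          (\<lambda>w. frechet_derivative (\<lambda>z. f (inv_into V y z)) (at (y (\<iota> p)))
            (frechet_derivative ?\<tau> (at (x p)) w))) (at (x p))"
        by (rule has_derivative_compose[OF \<tau>])
           (simp add: B.smooth_function_chart_derivative[OF V(1) True V(2), simplified])
      then have "((\<lambda>z. f (\<iota> (inv_into U x z))) has_derivative
          (\<lambda>w. frechet_derivative (\<lambda>z. f (inv_into V y z)) (at (y (\<iota> p)))
            (frechet_derivative ?\<tau> (at (x p)) w))) (at (x p))"
        by (rule has_derivative_transform_within_open[OF _ loc(1) xp])
           (auto simp: A.chart_inv[OF U(1)] B.chart_inv[OF V(1)])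
      from fun_cong[OF frechet_derivative_at[OF this], of w] show ?thesis
        by (simp add: True pullback_smooth w push_apply chart_tangent_def)
    qed (simp add: push_def chart_tangent_def)
  qed
  then show ?thesis using B.tangent_space_chart[OF V] by simp
qed

lemma field_along_tangent: "V \<in> fields_along A B \<iota> \<Longrightarrow> V p \<in> tangent_space B (\<iota> p)"
  and field_along_smooth:
    "V \<in> fields_along A B \<iota> \<Longrightarrow> f \<in> smooth_functions B \<Longrightarrow> (\<lambda>p. V p f) \<in> smooth_functions A"
  and field_alongI: "(\<And>p. V p \<in> tangent_space B (\<iota> p)) \<Longrightarrow>
    (\<And>f. f \<in> smooth_functions B \<Longrightarrow> (\<lambda>p. V p f) \<in> smooth_functions A) \<Longrightarrow> V \<in> fields_along A B \<iota>"
  by (simp_all add: fields_along_def)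

lemma push_field_along: "X \<in> vector_fields A \<Longrightarrow> (\<lambda>p. push B \<iota> (X p)) \<in> fields_along A B \<iota>"
  by (rule field_alongI)
     (auto intro: push_tangent A.vector_field_tangent A.vector_field_smooth pullback_smooth simp: push_apply)

lemma compose_field_along: "Y \<in> vector_fields B \<Longrightarrow> (\<lambda>p. Y (\<iota> p)) \<in> fields_along A B \<iota>"
  by (rule field_alongI) (auto intro: B.vector_field_tangent B.vector_field_smooth pullback_smooth)

lemma field_along_add:
  "V \<in> fields_along A B \<iota> \<Longrightarrow> W \<in> fields_along A B \<iota> \<Longrightarrow> V + W \<in> fields_along A B \<iota>"
  by (rule field_alongI)
     (auto intro: B.tangent_add A.smooth_add field_along_smooth field_along_tangent)

lemma field_along_scale:
  "a \<in> smooth_functions A \<Longrightarrow> V \<in> fields_along A B \<iota> \<Longrightarrow> (\<lambda>q. a q *\<^sub>R V q) \<in> fields_along A B \<iota>"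
  by (rule field_alongI)
     (auto intro: B.tangent_scale A.smooth_mult field_along_smooth field_along_tangent)

lemma field_along_0: "0 \<in> fields_along A B \<iota>"
  by (rule field_alongI) auto

lemma field_along_sum:
  "(\<And>i. i \<in> I \<Longrightarrow> V i \<in> fields_along A B \<iota>) \<Longrightarrow> (\<Sum>i\<in>I. V i) \<in> fields_along A B \<iota>"
  by (induction I rule: infinite_finite_induct) (auto intro: field_along_add field_along_0)

text \<open>The frame identity writes \<beta> L(V) as the sum of V(u_j) L(E_j), where only
  restrictions of ambient fields are inserted into L; \<open>smooth_divide\<close> then removes
  \<beta>. Tensors, forms and metrics, whose smoothness is given on ambient fields, thereby become
  applicable to all fields along \<iota>.\<close>

lemma smooth_along:
  assumes L: "\<And>p. linear_over (tangent_space B (\<iota> p)) (L p)"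
    and smooth: "\<And>Y. Y \<in> vector_fields B \<Longrightarrow> (\<lambda>p. L p (Y (\<iota> p))) \<in> smooth_functions A"
    and V: "V \<in> fields_along A B \<iota>"
  shows "(\<lambda>p. L p (V p) :: real) \<in> smooth_functions A"
proof (rule A.smooth_divide)
  fix p
  obtain \<beta> :: "'b \<Rightarrow> real" and u :: "'l option \<Rightarrow> 'b \<Rightarrow> real" and E :: "'l option \<Rightarrow> 'b field"
    where F: "dual_frame B \<beta> u E" and \<beta>0: "\<beta> (\<iota> p) \<noteq> 0"
    by (rule B.dual_frame_exists)
  note \<beta> = dual_frameD(1)[OF F] and u = dual_frameD(2)[OF F] and E = dual_frameD(3)[OF F]
    and frame = dual_frameD(4)[OF F]
  have "\<beta> (\<iota> q) * L q (V q) = (\<Sum>j\<in>UNIV. V q (u j) * L q (E j (\<iota> q)))" for q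
  proof -
    have "\<beta> (\<iota> q) * L q (V q) = L q (\<beta> (\<iota> q) *\<^sub>R V q)"
      using L[of q] field_along_tangent[OF V] by (simp add: linear_over_def)
    then show ?thesis
      by (simp add: frame field_along_tangent[OF V] B.vector_field_tangent[OF E]
          linear_over_sum[OF L B.subspace_tangent_space])
  qed
  then have "(\<lambda>q. \<beta> (\<iota> q) * L q (V q)) \<in> smooth_functions A"
    by (simp only:) (intro A.smooth_sum A.smooth_mult field_along_smooth[OF V] u smooth E)
  then show "\<exists>\<psi>\<in>smooth_functions A. \<psi> p \<noteq> 0 \<and> (\<lambda>q. \<psi> q * L q (V q)) \<in> smooth_functions A"
    using pullback_smooth[OF \<beta>] \<beta>0 by (intro bexI[of _ "\<lambda>q. \<beta> (\<iota> q)"]) auto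
qed

lemma tensor_along:
  assumes "tensor_field_1_1 B \<phi>" "V \<in> fields_along A B \<iota>"
  shows "(\<lambda>p. \<phi> (\<iota> p) (V p)) \<in> fields_along A B \<iota>"
proof (rule field_alongI)
  have \<phi>: "linear_over (tangent_space B q) (\<phi> q)" "v \<in> tangent_space B q \<Longrightarrow> \<phi> q v \<in> tangent_space B q"
    "Y \<in> vector_fields B \<Longrightarrow> (\<lambda>p. \<phi> p (Y p)) \<in> vector_fields B" for q v Y
    using assms(1) by (auto simp: tensor_field_1_1_def)
  show "\<phi> (\<iota> p) (V p) \<in> tangent_space B (\<iota> p)" for p
    by (rule \<phi>(2)[OF field_along_tangent[OF assms(2)]])
  show "(\<lambda>p. \<phi> (\<iota> p) (V p) f) \<in> smooth_functions A" if f: "f \<in> smooth_functions B" for f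
  \<comment> \<open>Evaluating at a test function f turns the vector-valued map into a real
    functional.\<close>
  proof (rule smooth_along[OF _ _ assms(2)])
    show "linear_over (tangent_space B (\<iota> p)) (\<lambda>v. \<phi> (\<iota> p) v f)" for p
      using \<phi>(1)[of "\<iota> p"] by (simp add: linear_over_def)
    show "(\<lambda>p. \<phi> (\<iota> p) (Y (\<iota> p)) f) \<in> smooth_functions A" if "Y \<in> vector_fields B" for Y
      by (rule pullback_smooth[OF B.vector_field_smooth[OF \<phi>(3)[OF that] f]])
  qed
qed

lemma one_form_along:
  assumes "one_form B \<omega>" "V \<in> fields_along A B \<iota>"
  shows "(\<lambda>p. \<omega> (\<iota> p) (V p)) \<in> smooth_functions A"
proof (rule smooth_along[OF _ _ assms(2)])
  show "linear_over (tangent_space B (\<iota> p)) (\<omega> (\<iota> p))" for p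
    using assms(1) by (simp add: one_form_def)
  show "(\<lambda>p. \<omega> (\<iota> p) (Y (\<iota> p))) \<in> smooth_functions A" if "Y \<in> vector_fields B" for Y
    by (rule pullback_smooth[of "\<lambda>q. \<omega> q (Y q)"]) (use assms(1) that in \<open>simp add: one_form_def\<close>)
qed

end

text \<open>With \<iota> = id, statements on pulled back connections can be read for the ambient
  connection itself.\<close>

lemma (in manifold) smooth_mapping_id: "smooth_mapping A A id"
proof
  show "smooth_map A A id"
    using chart_transition_smooth by (auto simp: smooth_map_def o_def vimage_def)
qed

text \<open>Restricted to tangent vectors, because \<open>push\<close> replaces the value at a
  non-smooth function by 0 and only such functionals are left unchanged.\<close>

lemma (in manifold) push_id: "v \<in> tangent_space A p \<Longrightarrow> push A id v = v"
  by (auto simp: push_def fun_eq_iff dest: tangent_not_smooth)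

section \<open>Riemannian immersions\<close>

locale riemannian_immersion = smooth_mapping A B \<iota>
  for A :: "('a::{t2_space, second_countable_topology}, 'k::finite) atlas"
    and B :: "('b::{t2_space, second_countable_topology}, 'l::finite) atlas"
    and \<iota> :: "'a \<Rightarrow> 'b" +
  fixes g :: "'b metric"
  assumes push_inj: "inj_on (push B \<iota>) (tangent_space A p)"
    and metric: "riemannian_metric B g"
begin

lemma metric_linear: "u \<in> tangent_space B q \<Longrightarrow> linear_over (tangent_space B q) (g q u)"
  and metric_sym: "u \<in> tangent_space B q \<Longrightarrow> v \<in> tangent_space B q \<Longrightarrow> g q u v = g q v u"
  and metric_pos: "u \<in> tangent_space B q \<Longrightarrow> u \<noteq> 0 \<Longrightarrow> g q u u > 0"
  and metric_smooth: "X \<in> vector_fields B \<Longrightarrow> Y \<in> vector_fields B \<Longrightarrow>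
    (\<lambda>q. g q (X q) (Y q)) \<in> smooth_functions B"
  using metric by (auto simp: riemannian_metric_def)

lemma metric_linear_left:
  assumes "v \<in> tangent_space B q"
  shows "linear_over (tangent_space B q) (\<lambda>u. g q u v)"
  using metric_linear[OF assms] metric_sym[OF assms] B.tangent_add B.tangent_scale
  unfolding linear_over_def by metis

text \<open>Two uses of \<open>smooth_along\<close>, freeing one argument at a time; in the inner
  one the first argument is still an ambient field.\<close>

lemma metric_smooth_along:
  assumes "V \<in> fields_along A B \<iota>" "W \<in> fields_along A B \<iota>"
  shows "(\<lambda>p. g (\<iota> p) (V p) (W p)) \<in> smooth_functions A"
proof (rule smooth_along[OF metric_linear_left[OF field_along_tangent[OF assms(2)]] _ assms(1)])
  fix Y assume Y: "Y \<in> vector_fields B"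
  show "(\<lambda>p. g (\<iota> p) (Y (\<iota> p)) (W p)) \<in> smooth_functions A"
    by (rule smooth_along[OF metric_linear[OF B.vector_field_tangent[OF Y]] _ assms(2)])
       (rule pullback_smooth[OF metric_smooth[OF Y]])
qed

lemma push_the_inv:
  assumes "w \<in> push B \<iota> ` tangent_space A p"
  shows "the_inv_into (tangent_space A p) (push B \<iota>) w \<in> tangent_space A p"
    and "push B \<iota> (the_inv_into (tangent_space A p) (push B \<iota>) w) = w"
  using assms the_inv_into_into[OF push_inj _ subset_refl] f_the_inv_into_f[OF push_inj] by auto

text \<open>
  The components of the lift \<open>X\<close> of \<open>V\<close> in a frame \<open>E\<close> solve the linear system with the Gram matrix
  of \<open>E\<close> and right-hand sides \<open>g (push (E i), V)\<close>, so Cramer's rule makes them smooth.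
\<close>

lemma lift_smooth:
  assumes V: "V \<in> fields_along A B \<iota>" and X: "\<And>p. X p \<in> tangent_space A p" "\<And>p. push B \<iota> (X p) = V p"
  shows "X \<in> vector_fields A"
proof (rule A.vector_fieldI[OF X(1)], rule A.smooth_divide)
  fix f p assume f: "f \<in> smooth_functions A"
  obtain b :: "'a \<Rightarrow> real" and u :: "'k \<Rightarrow> 'a \<Rightarrow> real" and E :: "'k \<Rightarrow> 'a field"
    where b: "b \<in> smooth_functions A" "b p \<noteq> 0" and u: "\<And>j. u j \<in> smooth_functions A"
      and E: "\<And>j. E j \<in> vector_fields A"
      and frame: "\<And>q v. v \<in> tangent_space A q \<Longrightarrow>
        (b q) ^ 3 *\<^sub>R v = (\<Sum>j\<in>UNIV. (b q * v (u j) - u j q * v b) *\<^sub>R E j q)"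
      and dual: "\<And>q i j. b q * E i q (u j) - u j q * E i q b = (if i = j then (b q) ^ 3 else 0)"
    by (rule A.coordinate_frame[of p]) (rule that)
  define G :: "'a \<Rightarrow> real ^ 'k ^ 'k"
    where "G q = (\<chi> i j. g (\<iota> q) (push B \<iota> (E i q)) (push B \<iota> (E j q)))" for q
  define M where "M k q = det (\<chi> i j. if j = k then g (\<iota> q) (push B \<iota> (E i q)) (V q) else G q $ i $ j)" for k q
  have Et: "E i q \<in> tangent_space A q" and PE: "push B \<iota> (E i q) \<in> tangent_space B (\<iota> q)" for i q
    using A.vector_field_tangent[OF E] push_tangent by auto
  have G_mult: "(G q *v c) $ i = g (\<iota> q) (push B \<iota> (E i q)) (push B \<iota> (\<Sum>j\<in>UNIV. c $ j *\<^sub>R E j q))" for q c i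
    by (simp add: G_def matrix_vector_mult_def push_sum push_scale mult.commute PE
        linear_over_sum[OF metric_linear[OF PE] B.subspace_tangent_space])
  have G_smooth: "(\<lambda>q. G q $ i $ j) \<in> smooth_functions A" for i j
    by (simp add: G_def) (intro metric_smooth_along push_field_along E)
  have entry: "(\<lambda>q. if j = k then g (\<iota> q) (push B \<iota> (E i q)) (V q) else G q $ i $ j) \<in> smooth_functions A" for i j k
    by (cases "j = k") (simp_all add: G_smooth metric_smooth_along[OF push_field_along[OF E] V])
  have det_smooth: "(\<lambda>q. det (\<chi> i j. F i j q)) \<in> smooth_functions A"
    if "\<And>i j. F i j \<in> smooth_functions A" for F :: "'k \<Rightarrow> 'k \<Rightarrow> 'a \<Rightarrow> real"
    unfolding det_def by (simp, intro A.smooth_sum A.smooth_mult A.smooth_prod A.smooth_const that)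
  have M_smooth: "M k \<in> smooth_functions A" for k
    unfolding M_def by (rule det_smooth[OF entry])
  have detG: "(\<lambda>q. det (G q)) \<in> smooth_functions A"
    using det_smooth[of "\<lambda>i j q. G q $ i $ j", OF G_smooth] by simp
  \<comment> \<open>The factor \<open>b q\<close> extends the identity to all points: where it is 0
    both sides vanish, elsewhere the \<open>E j\<close> are a frame and Cramer's rule
    applies.\<close>
  have eq: "b q * det (G q) * X q f = b q * (\<Sum>k\<in>UNIV. M k q * E k q f)" for q
  proof (cases "b q = 0")
    case False
    define c :: "real ^ 'k" where "c = (\<chi> j. (b q * X q (u j) - u j q * X q b) / b q ^ 3)"
    have c: "X q = (\<Sum>j\<in>UNIV. c $ j *\<^sub>R E j q)"
    proof -
      have "X q = inverse (b q ^ 3) *\<^sub>R (b q ^ 3 *\<^sub>R X q)" using False by simp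
      also have "\<dots> = (\<Sum>j\<in>UNIV. c $ j *\<^sub>R E j q)"
        unfolding frame[OF X(1)] c_def by (simp add: scaleR_sum_right divide_inverse mult.commute)
      finally show ?thesis .
    qed
    have "M k q = c $ k * det (G q)" for k
      unfolding M_def X(2)[symmetric] cramer_lemma[of k "G q" c, symmetric] G_mult c ..
    then have "(\<Sum>k\<in>UNIV. M k q * E k q f) = det (G q) * X q f"
      by (simp add: c sum_fun_apply sum_distrib_left mult_ac)
    then show ?thesis by simp
  qed simp
  have "(\<lambda>q. b q * (\<Sum>k\<in>UNIV. M k q * E k q f)) \<in> smooth_functions A"
    by (intro A.smooth_mult A.smooth_sum b A.vector_field_smooth[OF E f] M_smooth)
  then have "(\<lambda>q. b q * det (G q) * X q f) \<in> smooth_functions A" by (simp add: eq)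
  \<comment> \<open>If G c = 0, then w, the sum of the c_j E_j, has squared length c . G c = 0, so w
    = 0 because \<open>push\<close> is injective. The identity \<open>dual\<close> then recovers
    each c_j up to the nonzero factor b^3.\<close>
  moreover have "det (G p) \<noteq> 0"
  proof -
    have "c = 0" if c: "G p *v c = 0" for c
    proof -
      let ?w = "\<Sum>j\<in>UNIV. c $ j *\<^sub>R E j p"
      have w: "?w \<in> tangent_space A p" by (intro A.tangent_sum A.tangent_scale Et)
      have "g (\<iota> p) (push B \<iota> ?w) (push B \<iota> ?w) = (\<Sum>i\<in>UNIV. c $ i * (G p *v c) $ i)"
        unfolding G_mult
        by (subst (1) push_sum) (simp add: push_scale PE
            linear_over_sum[OF metric_linear_left[OF push_tangent[OF w]] B.subspace_tangent_space])
      then have "push B \<iota> ?w = push B \<iota> 0"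
        using metric_pos[OF push_tangent[OF w]] c by (fastforce simp: push_0)
      then have "?w = 0" using push_inj w A.tangent_0 by (meson inj_onD)
      have w0: "(\<Sum>i\<in>UNIV. c $ i * E i p f) = 0" for f
        using fun_cong[OF \<open>?w = 0\<close>, of f] by (simp add: sum_fun_apply)
      have "c $ j * b p ^ 3 = 0" for j
      proof -
        have "c $ j * b p ^ 3 = (\<Sum>i\<in>UNIV. c $ i * (b p * E i p (u j) - u j p * E i p b))"
          by (simp add: dual if_distrib cong: if_cong)
        also have "\<dots> = b p * (\<Sum>i\<in>UNIV. c $ i * E i p (u j)) - u j p * (\<Sum>i\<in>UNIV. c $ i * E i p b)"
          by (simp add: sum_distrib_left sum_subtractf[symmetric] algebra_simps)
        finally show ?thesis by (simp add: w0)
      qed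
      then show "c = 0" using b(2) by (simp add: vec_eq_iff)
    qed
    then show ?thesis
      by (metis invertible_det_nz invertible_left_inverse matrix_left_invertible_ker)
  qed
  ultimately show "\<exists>\<psi>\<in>smooth_functions A. \<psi> p \<noteq> 0 \<and> (\<lambda>q. \<psi> q * X q f) \<in> smooth_functions A"
    using b A.smooth_mult[OF b(1) detG] by (intro bexI[of _ "\<lambda>q. b q * det (G q)"]) auto
qed

end

section \<open>Pulled back connections\<close>

text \<open>The vector space part of \<open>torsion_defect\<close>: \<open>a1\<close> and
  \<open>a2\<close> stand for the second derivatives XY(u_j) and YX(u_j), which cancel against the
  bracket.\<close>

lemma torsion_algebra:
  fixes e d1 d2 :: "'i \<Rightarrow> 'v::real_vector"
  assumes "xb *\<^sub>R y + b *\<^sub>R D1 = (\<Sum>j\<in>I. a1 j *\<^sub>R e j + y' j *\<^sub>R d1 j)"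
    and "yb *\<^sub>R x + b *\<^sub>R D2 = (\<Sum>j\<in>I. a2 j *\<^sub>R e j + x' j *\<^sub>R d2 j)"
    and "b *\<^sub>R br = (\<Sum>j\<in>I. (a1 j - a2 j) *\<^sub>R e j)"
  shows "b *\<^sub>R (D1 - D2 - br) = (\<Sum>j\<in>I. y' j *\<^sub>R d1 j - x' j *\<^sub>R d2 j) - (xb *\<^sub>R y - yb *\<^sub>R x)"
proof -
  have "b *\<^sub>R D1 = (\<Sum>j\<in>I. a1 j *\<^sub>R e j + y' j *\<^sub>R d1 j) - xb *\<^sub>R y"
    "b *\<^sub>R D2 = (\<Sum>j\<in>I. a2 j *\<^sub>R e j + x' j *\<^sub>R d2 j) - yb *\<^sub>R x"
    using assms(1,2) by (simp_all add: eq_diff_eq add.commute)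
  then show ?thesis
    by (simp add: scaleR_diff_right assms(3) scaleR_diff_left sum_subtractf sum.distrib)
qed

section \<open>Covariant derivatives computed through a frame\<close>

context smooth_mapping
begin

context
  fixes D assumes connection: "connection_along A B \<iota> D"
begin

lemma connection_linear: "V \<in> fields_along A B \<iota> \<Longrightarrow> linear_over (tangent_space A p) (\<lambda>v. D p v V)"
  and connection_tangent:
    "V \<in> fields_along A B \<iota> \<Longrightarrow> v \<in> tangent_space A p \<Longrightarrow> D p v V \<in> tangent_space B (\<iota> p)"
  and connection_add: "V \<in> fields_along A B \<iota> \<Longrightarrow> W \<in> fields_along A B \<iota> \<Longrightarrow>
    v \<in> tangent_space A p \<Longrightarrow> D p v (V + W) = D p v V + D p v W"
  and connection_leibniz: "V \<in> fields_along A B \<iota> \<Longrightarrow> a \<in> smooth_functions A \<Longrightarrow>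
    v \<in> tangent_space A p \<Longrightarrow> D p v (\<lambda>q. a q *\<^sub>R V q) = v a *\<^sub>R V p + a p *\<^sub>R D p v V"
  using connection by (simp_all add: connection_along_def)

lemma connection_0: "v \<in> tangent_space A p \<Longrightarrow> D p v 0 = 0"
  using connection_add[OF field_along_0 field_along_0, of v p] by (simp only: add_0_right add_cancel_right_right)

lemma connection_sum:
  assumes "v \<in> tangent_space A p" "\<And>i. i \<in> I \<Longrightarrow> V i \<in> fields_along A B \<iota>"
  shows "D p v (\<Sum>i\<in>I. V i) = (\<Sum>i\<in>I. D p v (V i))"
  using assms(2)
proof (induction I rule: infinite_finite_induct)
  case (insert i I)
  have "D p v (V i + (\<Sum>i\<in>I. V i)) = D p v (V i) + D p v (\<Sum>i\<in>I. V i)"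
    by (rule connection_add[OF _ field_along_sum assms(1)]) (use insert.prems in auto)
  with insert show ?case by (simp only: sum.insert not_False_eq_True insertI2)
qed (simp_all only: sum.infinite sum.empty connection_0[OF assms(1)] not_False_eq_True)

text \<open>The Leibniz rule applied to both sides of \<beta> V = sum of V(u_j) E_j; afterwards the
  field V enters the right hand side only through the functions V(u_j).\<close>

lemma frame_derivative:
  fixes u :: "'i::finite \<Rightarrow> 'b \<Rightarrow> real"
  assumes F: "dual_frame B \<beta> u E"
    and V: "V \<in> fields_along A B \<iota>" and v: "v \<in> tangent_space A p"
  shows "v (\<lambda>q. \<beta> (\<iota> q)) *\<^sub>R V p + \<beta> (\<iota> p) *\<^sub>R D p v V =
    (\<Sum>j\<in>UNIV. v (\<lambda>q. V q (u j)) *\<^sub>R E j (\<iota> p) + V p (u j) *\<^sub>R D p v (\<lambda>q. E j (\<iota> q)))"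
proof -
  note \<beta> = dual_frameD(1)[OF F] and u = dual_frameD(2)[OF F] and E = dual_frameD(3)[OF F]
    and frame = dual_frameD(4)[OF F]
  note Vu = field_along_smooth[OF V u] and Ei = compose_field_along[OF E]
  have "(\<lambda>q. \<beta> (\<iota> q) *\<^sub>R V q) = (\<Sum>j\<in>UNIV. (\<lambda>q. V q (u j) *\<^sub>R E j (\<iota> q)))"
    by (rule ext, subst sum_fun_apply) (rule frame[OF field_along_tangent[OF V]])
  then have "D p v (\<lambda>q. \<beta> (\<iota> q) *\<^sub>R V q) = (\<Sum>j\<in>UNIV. D p v (\<lambda>q. V q (u j) *\<^sub>R E j (\<iota> q)))"
    by (simp only: connection_sum[OF v field_along_scale[OF Vu Ei]])
  then show ?thesis
    by (simp only: connection_leibniz[OF V pullback_smooth[OF \<beta>] v] connection_leibniz[OF Ei Vu v])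
qed

end

context
  fixes D' D assumes pullback: "pullback_connection A B \<iota> D' D"
begin

lemma pullback_connection_along: "connection_along A B \<iota> D"
  using pullback by (simp add: pullback_connection_def)

lemma pullback_compose:
  "v \<in> tangent_space A p \<Longrightarrow> Y \<in> vector_fields B \<Longrightarrow> D p v (\<lambda>q. Y (\<iota> q)) = D' (\<iota> p) (push B \<iota> v) Y"
  using pullback by (simp add: pullback_connection_def o_def)

text \<open>
  The right hand side depends only on the vectors \<open>push B \<iota> (X p)\<close> and \<open>push B \<iota> (Y p)\<close>, so
  torsion-freeness can be transferred from \<open>\<iota> = id\<close> by extending these vectors.
\<close>

lemma torsion_defect:
  fixes u :: "'i::finite \<Rightarrow> 'b \<Rightarrow> real" and p :: 'a
  assumes F: "dual_frame B \<beta> u E"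
    and X: "X \<in> vector_fields A" and Y: "Y \<in> vector_fields A"
    and bracket: "lie_bracket A X Y p \<in> tangent_space A p"
  defines "x \<equiv> push B \<iota> (X p)" and "y \<equiv> push B \<iota> (Y p)"
  shows "\<beta> (\<iota> p) *\<^sub>R (D p (X p) (\<lambda>q. push B \<iota> (Y q)) - D p (Y p) (\<lambda>q. push B \<iota> (X q))
      - push B \<iota> (lie_bracket A X Y p)) =
    (\<Sum>j\<in>UNIV. y (u j) *\<^sub>R D' (\<iota> p) x (E j) - x (u j) *\<^sub>R D' (\<iota> p) y (E j)) - (x \<beta> *\<^sub>R y - y \<beta> *\<^sub>R x)"
proof (rule torsion_algebra)
  note \<beta> = dual_frameD(1)[OF F] and u = dual_frameD(2)[OF F] and E = dual_frameD(3)[OF F]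
    and frame = dual_frameD(4)[OF F]
  note fd = frame_derivative[OF pullback_connection_along F]
  note Xp = A.vector_field_tangent[OF X, of p] and Yp = A.vector_field_tangent[OF Y, of p]
  show "x \<beta> *\<^sub>R y + \<beta> (\<iota> p) *\<^sub>R D p (X p) (\<lambda>q. push B \<iota> (Y q)) =
      (\<Sum>j\<in>UNIV. X p (\<lambda>q. Y q (\<lambda>q. u j (\<iota> q))) *\<^sub>R E j (\<iota> p) + y (u j) *\<^sub>R D' (\<iota> p) x (E j))"
    using fd[OF push_field_along[OF Y] Xp] by (simp only: x_def y_def push_apply \<beta> u pullback_compose[OF Xp E])
  show "y \<beta> *\<^sub>R x + \<beta> (\<iota> p) *\<^sub>R D p (Y p) (\<lambda>q. push B \<iota> (X q)) =
      (\<Sum>j\<in>UNIV. Y p (\<lambda>q. X q (\<lambda>q. u j (\<iota> q))) *\<^sub>R E j (\<iota> p) + x (u j) *\<^sub>R D' (\<iota> p) y (E j))"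
    using fd[OF push_field_along[OF X] Yp] by (simp only: x_def y_def push_apply \<beta> u pullback_compose[OF Yp E])
  have "lie_bracket A X Y p (\<lambda>q. u j (\<iota> q)) =
      X p (\<lambda>q. Y q (\<lambda>q. u j (\<iota> q))) - Y p (\<lambda>q. X q (\<lambda>q. u j (\<iota> q)))" for j
    by (simp add: lie_bracket_def pullback_smooth u)
  then show "\<beta> (\<iota> p) *\<^sub>R push B \<iota> (lie_bracket A X Y p) =
      (\<Sum>j\<in>UNIV. (X p (\<lambda>q. Y q (\<lambda>q. u j (\<iota> q))) - Y p (\<lambda>q. X q (\<lambda>q. u j (\<iota> q)))) *\<^sub>R E j (\<iota> p))"
    by (simp only: frame[OF push_tangent[OF bracket]] push_apply u)
qed

end

end

context manifold
begin

context
  fixes g D assumes levi_civita: "levi_civita A g D"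
begin

lemma levi_civita_connection: "connection_along A A id D"
  using levi_civita by (simp add: levi_civita_def)

lemma levi_civita_field:
  assumes "X \<in> vector_fields A" "Y \<in> vector_fields A"
  shows "(\<lambda>p. D p (X p) Y) \<in> vector_fields A"
  using levi_civita_connection assms by (simp add: connection_along_def vector_fields_def)

lemma levi_civita_torsion_free:
  assumes "X \<in> vector_fields A" "Y \<in> vector_fields A"
  shows "D p (X p) Y - D p (Y p) X = lie_bracket A X Y p"
proof -
  have "cov D X Y - cov D Y X = lie_bracket A X Y"
    using levi_civita assms by (simp add: levi_civita_def)
  from fun_cong[OF this, of p] show ?thesis by (simp add: cov_def)
qed

lemma levi_civita_metric:
  assumes "X \<in> vector_fields A" "Y \<in> vector_fields A" "Z \<in> vector_fields A"
  shows "X p (\<lambda>q. g q (Y q) (Z q)) = g p (D p (X p) Y) (Z p) + g p (Y p) (D p (X p) Z)"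
  using levi_civita assms by (simp add: levi_civita_def cov_def)

text \<open>The bracket is a difference of two covariant derivatives, both tangent; this avoids a
  coordinate computation with the symmetry of second derivatives.\<close>

lemma levi_civita_bracket_tangent:
  assumes "X \<in> vector_fields A" "Y \<in> vector_fields A"
  shows "lie_bracket A X Y p \<in> tangent_space A p"
  using tangent_diff[OF vector_field_tangent[OF levi_civita_field[OF assms], of p]
      vector_field_tangent[OF levi_civita_field[OF assms(2,1)], of p]]
  by (simp only: levi_civita_torsion_free[OF assms])

lemma levi_civita_pullback_id: "pullback_connection A A id D D"
  using levi_civita_connection by (auto simp: pullback_connection_def push_id)

end

end

lemma (in smooth_mapping) pullback_torsion_free:
  assumes LC: "levi_civita B g D'" and pullback: "pullback_connection A B \<iota> D' D"
    and X: "X \<in> vector_fields A" and Y: "Y \<in> vector_fields A"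
    and bracket: "lie_bracket A X Y p \<in> tangent_space A p"
  shows "D p (X p) (\<lambda>q. push B \<iota> (Y q)) - D p (Y p) (\<lambda>q. push B \<iota> (X q)) =
    push B \<iota> (lie_bracket A X Y p)"
proof -
  let ?q = "\<iota> p"
  obtain \<beta> :: "'b \<Rightarrow> real" and u :: "'l option \<Rightarrow> 'b \<Rightarrow> real" and E :: "'l option \<Rightarrow> 'b field"
    where F: "dual_frame B \<beta> u E" and \<beta>0: "\<beta> (\<iota> p) \<noteq> 0"
    by (rule B.dual_frame_exists)
  \<comment> \<open>The extension agrees with the pushed vector at this one point only; it need not
    be \<iota>-related to X.\<close>
  obtain X' where X': "X' \<in> vector_fields B" "X' ?q = push B \<iota> (X p)"
    by (rule B.vector_field_through[OF push_tangent[OF A.vector_field_tangent[OF X]]])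
  obtain Y' where Y': "Y' \<in> vector_fields B" "Y' ?q = push B \<iota> (Y p)"
    by (rule B.vector_field_through[OF push_tangent[OF A.vector_field_tangent[OF Y]]])
  interpret id: smooth_mapping B B id by (rule B.smooth_mapping_id)
  note br = B.levi_civita_bracket_tangent[OF LC X'(1) Y'(1)]
  have "(\<lambda>q. push B id (Z q)) = Z" if "Z \<in> vector_fields B" for Z
    using B.push_id[OF B.vector_field_tangent[OF that]] by auto
  note [simp] = this[OF X'(1)] this[OF Y'(1)] B.push_id[OF B.vector_field_tangent]
    B.push_id[OF br] B.levi_civita_torsion_free[OF LC X'(1) Y'(1)]
  \<comment> \<open>The defect for \<iota> = id, which is 0 because the ambient connection is
    torsion-free.\<close>
  have "(\<Sum>j\<in>UNIV. Y' ?q (u j) *\<^sub>R D' ?q (X' ?q) (E j) - X' ?q (u j) *\<^sub>R D' ?q (Y' ?q) (E j))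
      - (X' ?q \<beta> *\<^sub>R Y' ?q - Y' ?q \<beta> *\<^sub>R X' ?q) = 0"
    using id.torsion_defect[OF B.levi_civita_pullback_id[OF LC] F X'(1) Y'(1) br]
    by (simp add: X'(1) Y'(1))
  then have "\<beta> ?q *\<^sub>R (D p (X p) (\<lambda>q. push B \<iota> (Y q)) - D p (Y p) (\<lambda>q. push B \<iota> (X q))
      - push B \<iota> (lie_bracket A X Y p)) = 0"
    unfolding torsion_defect[OF pullback F X Y bracket] X'(2) Y'(2) .
  then show ?thesis using \<beta>0 by (simp only: scaleR_eq_0_iff right_minus_eq simp_thms)
qed

section \<open>Metric compatibility of the pulled back connection\<close>

context riemannian_immersion
begin

text \<open>Frees the first argument. Differentiating \<beta> g(V, W) = sum of V(u_j) g(E_j, W)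
  gives terms with derivatives of \<beta> and V(u_j), which \<open>frame_derivative\<close> accounts
  for, and derivatives of g(E_j, W), which \<open>base\<close> provides.\<close>

lemma pullback_metric_step:
  assumes D: "connection_along A B \<iota> D"
    and V: "V \<in> fields_along A B \<iota>" and W: "W \<in> fields_along A B \<iota>" and v: "v \<in> tangent_space A p"
    and base: "\<And>E. E \<in> vector_fields B \<Longrightarrow> v (\<lambda>q. g (\<iota> q) (E (\<iota> q)) (W q)) =
      g (\<iota> p) (D p v (\<lambda>q. E (\<iota> q))) (W p) + g (\<iota> p) (E (\<iota> p)) (D p v W)"
  shows "v (\<lambda>q. g (\<iota> q) (V q) (W q)) = g (\<iota> p) (D p v V) (W p) + g (\<iota> p) (V p) (D p v W)"
proof -
  let ?q = "\<iota> p"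
  obtain \<beta> :: "'b \<Rightarrow> real" and u :: "'l option \<Rightarrow> 'b \<Rightarrow> real" and E :: "'l option \<Rightarrow> 'b field"
    where F: "dual_frame B \<beta> u E" and \<beta>0: "\<beta> (\<iota> p) \<noteq> 0"
    by (rule B.dual_frame_exists)
  note \<beta> = dual_frameD(1)[OF F] and u = dual_frameD(2)[OF F] and E = dual_frameD(3)[OF F]
    and frame = dual_frameD(4)[OF F]
  note Vt = field_along_tangent[OF V] and Wt = field_along_tangent[OF W]
  note Ei = compose_field_along[OF E] and Et = B.vector_field_tangent[OF E]
  note Dt = connection_tangent[OF D _ v]
  have pair: "\<beta> (\<iota> q) * g (\<iota> q) (V q) w = (\<Sum>j\<in>UNIV. V q (u j) * g (\<iota> q) (E j (\<iota> q)) w)"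
    if w: "w \<in> tangent_space B (\<iota> q)" for q w
  proof -
    have "\<beta> (\<iota> q) * g (\<iota> q) (V q) w = g (\<iota> q) (\<beta> (\<iota> q) *\<^sub>R V q) w"
      using metric_linear_left[OF w] Vt by (simp add: linear_over_def)
    then show ?thesis
      by (simp add: frame[OF Vt] linear_over_sum[OF metric_linear_left[OF w] B.subspace_tangent_space Et])
  qed
  note gs = metric_smooth_along[OF _ W]
  have "v (\<lambda>q. \<beta> (\<iota> q) * g (\<iota> q) (V q) (W q)) = v (\<lambda>q. \<Sum>j\<in>UNIV. V q (u j) * g (\<iota> q) (E j (\<iota> q)) (W q))"
    by (simp only: pair[OF Wt])
  then have 1: "\<beta> ?q * v (\<lambda>q. g (\<iota> q) (V q) (W q)) + g ?q (V p) (W p) * v (\<lambda>q. \<beta> (\<iota> q)) =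
      (\<Sum>j\<in>UNIV. V p (u j) * v (\<lambda>q. g (\<iota> q) (E j (\<iota> q)) (W q)) + g ?q (E j ?q) (W p) * v (\<lambda>q. V q (u j)))"
    using A.tangent_times[OF v pullback_smooth[OF \<beta>] gs[OF V]]
      A.tangent_sum_apply[OF v A.smooth_mult[OF field_along_smooth[OF V u] gs[OF Ei]]]
      A.tangent_times[OF v field_along_smooth[OF V u] gs[OF Ei]] by simp
  note lin = metric_linear_left[OF Wt, of p]
  note add = lin[unfolded linear_over_def, THEN conjunct1, rule_format]
    and scale = lin[unfolded linear_over_def, THEN conjunct2, rule_format]
  have "g ?q (v (\<lambda>q. \<beta> (\<iota> q)) *\<^sub>R V p + \<beta> ?q *\<^sub>R D p v V) (W p) =
      v (\<lambda>q. \<beta> (\<iota> q)) * g ?q (V p) (W p) + \<beta> ?q * g ?q (D p v V) (W p)"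
    by (simp only: add scale B.tangent_scale Vt Dt[OF V] real_scaleR_def)
  moreover have "g ?q (\<Sum>j\<in>UNIV. v (\<lambda>q. V q (u j)) *\<^sub>R E j ?q + V p (u j) *\<^sub>R D p v (\<lambda>q. E j (\<iota> q))) (W p) =
      (\<Sum>j\<in>UNIV. v (\<lambda>q. V q (u j)) * g ?q (E j ?q) (W p) + V p (u j) * g ?q (D p v (\<lambda>q. E j (\<iota> q))) (W p))"
    \<comment> \<open>Each summand is itself a sum of two multiples, so linearity is used with all
      coefficients equal to 1.\<close>
    using linear_over_sum[OF lin B.subspace_tangent_space, of UNIV "\<lambda>j. v (\<lambda>q. V q (u j)) *\<^sub>R E j ?q + V p (u j) *\<^sub>R D p v (\<lambda>q. E j (\<iota> q))" "\<lambda>_. 1"]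
    by (simp only: add scale B.tangent_add B.tangent_scale Et Dt[OF Ei] real_scaleR_def scaleR_one mult_1)
  ultimately have 2: "v (\<lambda>q. \<beta> (\<iota> q)) * g ?q (V p) (W p) + \<beta> ?q * g ?q (D p v V) (W p) =
      (\<Sum>j\<in>UNIV. v (\<lambda>q. V q (u j)) * g ?q (E j ?q) (W p) + V p (u j) * g ?q (D p v (\<lambda>q. E j (\<iota> q))) (W p))"
    by (simp only: frame_derivative[OF D F V v])
  have "\<beta> ?q * v (\<lambda>q. g (\<iota> q) (V q) (W q)) = \<beta> ?q * (g ?q (D p v V) (W p) + g ?q (V p) (D p v W))"
    using 1 2 pair[OF Dt[OF W]]
    by (simp add: base[OF E] sum.distrib distrib_left mult_ac)
  then show ?thesis using \<beta>0 by simp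
qed

lemma pullback_metric:
  assumes LC: "levi_civita B g D'" and pullback: "pullback_connection A B \<iota> D' D"
    and V: "V \<in> fields_along A B \<iota>" and W: "W \<in> fields_along A B \<iota>" and v: "v \<in> tangent_space A p"
  shows "v (\<lambda>q. g (\<iota> q) (V q) (W q)) = g (\<iota> p) (D p v V) (W p) + g (\<iota> p) (V p) (D p v W)"
proof -
  note D = pullback_connection_along[OF pullback]
  note Dt = connection_tangent[OF D _ v]
  note ft = field_along_tangent
  \<comment> \<open>Compatibility of the ambient connection is stated for fields as directions, so
    the pushed vector is extended.\<close>
  obtain X where X: "X \<in> vector_fields B" "X (\<iota> p) = push B \<iota> v"
    by (rule B.vector_field_through[OF push_tangent[OF v]])
  have fields: "v (\<lambda>q. g (\<iota> q) (E (\<iota> q)) (F (\<iota> q))) = g (\<iota> p) (D p v (\<lambda>q. E (\<iota> q))) (F (\<iota> p))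
      + g (\<iota> p) (E (\<iota> p)) (D p v (\<lambda>q. F (\<iota> q)))"
    if E: "E \<in> vector_fields B" and F: "F \<in> vector_fields B" for E F
    using B.levi_civita_metric[OF LC X(1) E F, of "\<iota> p"]
    by (simp add: X(2) push_apply metric_smooth E F pullback_compose[OF pullback v])
  have sym: "v (\<lambda>q. g (\<iota> q) (V q) (W q)) = v (\<lambda>q. g (\<iota> q) (W q) (V q))"
    if "V \<in> fields_along A B \<iota>" "W \<in> fields_along A B \<iota>" for V W
    by (simp only: metric_sym[OF ft[OF that(1)] ft[OF that(2)]])
  \<comment> \<open>The step lemma frees only the first argument, so the second one is freed by
    swapping both with the symmetry of g.\<close>
  have half: "v (\<lambda>q. g (\<iota> q) (E (\<iota> q)) (W q)) = g (\<iota> p) (D p v (\<lambda>q. E (\<iota> q))) (W p)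
      + g (\<iota> p) (E (\<iota> p)) (D p v W)" if E: "E \<in> vector_fields B" for E
  proof -
    note Ei = compose_field_along[OF E]
    have "v (\<lambda>q. g (\<iota> q) (W q) (E (\<iota> q))) =
        g (\<iota> p) (D p v W) (E (\<iota> p)) + g (\<iota> p) (W p) (D p v (\<lambda>q. E (\<iota> q)))"
      by (rule pullback_metric_step[OF D W Ei v]) (rule fields[OF _ E])
    then show ?thesis
      unfolding sym[OF Ei W]
      using metric_sym[OF ft[OF Ei] Dt[OF W]] metric_sym[OF Dt[OF Ei] ft[OF W]] by simp
  qed
  show ?thesis by (rule pullback_metric_step[OF D V W v half])
qed

end

section \<open>The Gauss formula\<close>

locale gauss_formula = riemannian_immersion A B \<iota> g
  for A :: "('a::{t2_space, second_countable_topology}, 'k::finite) atlas"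
    and B :: "('b::{t2_space, second_countable_topology}, 'l::finite) atlas"
    and \<iota> :: "'a \<Rightarrow> 'b" and g :: "'b metric" +
  fixes DB :: "('b, 'b) connection" and DI :: "('a, 'b) connection" and DM :: "('a, 'a) connection"
  assumes DB: "levi_civita B g DB"
    and DI: "pullback_connection A B \<iota> DB DI"
    and DM: "levi_civita A (induced_metric B \<iota> g) DM"
begin

abbreviation h :: "'a field \<Rightarrow> 'a field \<Rightarrow> 'a \<Rightarrow> 'b tangent" where
  "h \<equiv> second_fundamental_form B \<iota> DI DM"

lemma h_apply: "h X Y p = DI p (X p) (\<lambda>q. push B \<iota> (Y q)) - push B \<iota> (DM p (X p) Y)"
  by (simp add: second_fundamental_form_def cov_def o_def)

lemmas DI_connection = pullback_connection_along[OF DI]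
  and DM_field = A.levi_civita_field[OF DM]

lemma DM_tangent: "Y \<in> vector_fields A \<Longrightarrow> v \<in> tangent_space A p \<Longrightarrow> DM p v Y \<in> tangent_space A p"
  and DM_linear: "Y \<in> vector_fields A \<Longrightarrow> linear_over (tangent_space A p) (\<lambda>v. DM p v Y)"
  using A.levi_civita_connection[OF DM] by (simp_all add: connection_along_def vector_fields_def)

text \<open>Both connections are torsion-free with the same bracket of X and Y, which cancels in the
  difference.\<close>

lemma h_sym:
  assumes "X \<in> vector_fields A" "Y \<in> vector_fields A"
  shows "h X Y p = h Y X p"
proof -
  note br = A.levi_civita_bracket_tangent[OF DM assms]
  show ?thesis
    using pullback_torsion_free[OF DB DI assms br[of p]]
      arg_cong[OF A.levi_civita_torsion_free[OF DM assms, of p], of "push B \<iota>"]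
    unfolding h_apply push_diff by (simp only: algebra_simps)
qed

text \<open>\<open>g (h X Y, Z)\<close> is symmetric in \<open>X\<close>, \<open>Y\<close> and skew in \<open>Y\<close>, \<open>Z\<close>.\<close>

lemma h_normal:
  assumes "X \<in> vector_fields A" "Y \<in> vector_fields A" "Z \<in> vector_fields A"
  shows "g (\<iota> p) (h X Y p) (push B \<iota> (Z p)) = 0"
proof -
  define S where "S X Y Z = g (\<iota> p) (h X Y p) (push B \<iota> (Z p))" for X Y Z
  have skew: "S X Y Z = - S X Z Y"
    if X: "X \<in> vector_fields A" and Y: "Y \<in> vector_fields A" and Z: "Z \<in> vector_fields A" for X Y Z
  proof -
    note Xp = A.vector_field_tangent[OF X, of p]
    have PY: "push B \<iota> (Y p) \<in> tangent_space B (\<iota> p)" and PZ: "push B \<iota> (Z p) \<in> tangent_space B (\<iota> p)"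
      by (rule push_tangent[OF A.vector_field_tangent], fact)+
    have DY: "DI p (X p) (\<lambda>q. push B \<iota> (Y q)) \<in> tangent_space B (\<iota> p)"
      and DZ: "DI p (X p) (\<lambda>q. push B \<iota> (Z q)) \<in> tangent_space B (\<iota> p)"
      by (rule connection_tangent[OF DI_connection push_field_along Xp], fact)+
    have MY: "push B \<iota> (DM p (X p) Y) \<in> tangent_space B (\<iota> p)"
      and MZ: "push B \<iota> (DM p (X p) Z) \<in> tangent_space B (\<iota> p)"
      by (rule push_tangent[OF DM_tangent[OF _ Xp]], fact)+
    have diff: "g (\<iota> p) (u - v) w = g (\<iota> p) u w - g (\<iota> p) v w"
      if "u \<in> tangent_space B (\<iota> p)" "v \<in> tangent_space B (\<iota> p)" "w \<in> tangent_space B (\<iota> p)" for u v w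
    proof -
      have "g (\<iota> p) (u - v + v) w = g (\<iota> p) (u - v) w + g (\<iota> p) v w"
        using metric_linear_left[OF that(3)] that B.tangent_diff unfolding linear_over_def by blast
      then show ?thesis by simp
    qed
    have "X p (\<lambda>q. g (\<iota> q) (push B \<iota> (Y q)) (push B \<iota> (Z q))) =
        g (\<iota> p) (push B \<iota> (DM p (X p) Y)) (push B \<iota> (Z p)) + g (\<iota> p) (push B \<iota> (Y p)) (push B \<iota> (DM p (X p) Z))"
      using A.levi_civita_metric[OF DM that, of p] by (simp add: induced_metric_def)
    then show ?thesis
      using pullback_metric[OF DB DI push_field_along[OF Y] push_field_along[OF Z] Xp]
      by (simp add: S_def h_apply diff DY DZ MY MZ PY PZ metric_sym[OF PY DZ] metric_sym[OF PY MZ])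
  qed
  have sym: "S X Y Z = S Y X Z" if "X \<in> vector_fields A" "Y \<in> vector_fields A" for X Y Z
    by (simp only: S_def h_sym[OF that])
  \<comment> \<open>Alternating symmetry and skewness, three times each, returns the arguments to
    their places with an odd number of signs.\<close>
  have "S X Y Z = - S X Y Z"
    using skew[of Y X Z] skew[of Z Y X] skew[of X Z Y] sym[of X Y Z] sym[of Y Z X] sym[of Z X Y] assms by simp
  then show ?thesis by (simp add: S_def)
qed

lemma normal_push_eq_0:
  assumes "w \<in> tangent_space A p" "\<And>v. v \<in> tangent_space A p \<Longrightarrow> g (\<iota> p) (push B \<iota> w) (push B \<iota> v) = 0"
  shows "push B \<iota> w = 0"
  using metric_pos[OF push_tangent[OF assms(1)]] assms(2)[OF assms(1)] by fastforce

text \<open>If the ambient derivative is tangential, then so is \<open>h X Y p\<close>, which is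
  also normal and hence orthogonal to itself.\<close>

lemma h_eq_0:
  assumes X: "X \<in> vector_fields A" and Y: "Y \<in> vector_fields A"
    and tangential: "DI p (X p) (\<lambda>q. push B \<iota> (Y q)) \<in> push B \<iota> ` tangent_space A p"
  shows "h X Y p = 0"
proof -
  obtain u where u: "u \<in> tangent_space A p" "DI p (X p) (\<lambda>q. push B \<iota> (Y q)) = push B \<iota> u"
    using tangential by blast
  have w: "u - DM p (X p) Y \<in> tangent_space A p"
    by (intro A.tangent_diff u DM_tangent Y A.vector_field_tangent X)
  have h: "h X Y p = push B \<iota> (u - DM p (X p) Y)"
    by (simp only: h_apply u(2) push_diff)
  show ?thesis unfolding h
  proof (rule normal_push_eq_0[OF w])
    fix v assume "v \<in> tangent_space A p"
    then obtain Z where "Z \<in> vector_fields A" "Z p = v" by (rule A.vector_field_through)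
    then show "g (\<iota> p) (push B \<iota> (u - DM p (X p) Y)) (push B \<iota> v) = 0"
      using h_normal[OF X Y, of Z p] h by simp
  qed
qed

text \<open>\<open>normal_part\<close> is a definite description, so even its value at 0 needs
  uniqueness: a normal w with - w tangential is 0. It is evaluated only at derivatives of vanishing
  fields \<open>h Y Z\<close>.\<close>

lemma normal_part_0: "normal_part A B \<iota> g p 0 = 0"
  unfolding normal_part_def
proof (rule the_equality)
  have "g (\<iota> p) 0 (push B \<iota> v) = 0" if "v \<in> tangent_space A p" for v
    using metric_linear_left[OF push_tangent[OF that]] B.tangent_0
    unfolding linear_over_def by (metis real_scaleR_def mult_zero_left scaleR_zero_left)
  then show "0 \<in> normal_space A B \<iota> g p \<and> 0 - 0 \<in> push B \<iota> ` tangent_space A p"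
    using A.tangent_0[of p] push_0[of B \<iota>] by (simp add: normal_space_def)
next
  fix w assume w: "w \<in> normal_space A B \<iota> g p \<and> 0 - w \<in> push B \<iota> ` tangent_space A p"
  then obtain u where u: "u \<in> tangent_space A p" "0 - w = push B \<iota> u" by blast
  have "w = push B \<iota> ((-1) *\<^sub>R u)"
    unfolding push_scale u(2)[symmetric] by (simp only: scaleR_minus1_left diff_0 minus_minus)
  moreover have "push B \<iota> ((-1) *\<^sub>R u) = 0"
    by (rule normal_push_eq_0[OF A.tangent_scale[OF u(1)]])
       (use w calculation in \<open>auto simp only: normal_space_def\<close>)
  ultimately show "w = 0" by simp
qed

text \<open>The first argument of \<open>h\<close> matters only through its vector at p. Phrased for
  vectors, linearity admits identities that hold merely pointwise.\<close>

lemma h_linear: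
  assumes "Y \<in> vector_fields A"
  shows "linear_over (tangent_space A p) (\<lambda>v. DI p v (\<lambda>q. push B \<iota> (Y q)) - push B \<iota> (DM p v Y))"
proof -
  note lin = connection_linear[OF DI_connection push_field_along[OF assms], of p, unfolded linear_over_def]
    and lin' = DM_linear[OF assms, of p, unfolded linear_over_def]
  note add = lin[THEN conjunct1, rule_format] lin'[THEN conjunct1, rule_format]
    and scale = lin[THEN conjunct2, rule_format] lin'[THEN conjunct2, rule_format]
  show ?thesis
    unfolding linear_over_def
    by (intro conjI ballI allI) (simp_all only: add scale push_add push_scale add_diff_add scaleR_diff_right)
qed

end

section \<open>Invariant submanifolds\<close>

locale invariant_immersion = gauss_formula A B \<iota> g DB DI DM
  for A :: "('a::{t2_space, second_countable_topology}, 'k::finite) atlas"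
    and B :: "('b::{t2_space, second_countable_topology}, 'l::finite) atlas"
    and \<iota> :: "'a \<Rightarrow> 'b" and g :: "'b metric"
    and DB :: "('b, 'b) connection" and DI :: "('a, 'b) connection" and DM :: "('a, 'a) connection" +
  fixes \<phi> :: "'b \<Rightarrow> 'b tangent \<Rightarrow> 'b tangent" and \<xi> :: "'b field" and \<eta> :: "'b \<Rightarrow> 'b tangent \<Rightarrow> real"
    and f1 f3 :: "'b \<Rightarrow> real" and SI :: "('a, 'b) connection"
  assumes acm: "almost_contact_metric B g \<phi> \<xi> \<eta>"
    and structure_eqs: "structure_equations B g \<phi> \<xi> \<eta> f1 f3 DB"
    and invariant: "\<xi> (\<iota> p) \<in> push B \<iota> ` tangent_space A p"
      "\<phi> (\<iota> p) ` push B \<iota> ` tangent_space A p \<subseteq> push B \<iota> ` tangent_space A p"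
    and SI: "connection_along A B \<iota> SI"
begin

abbreviation \<xi>\<^sub>M :: "'a field" where "\<xi>\<^sub>M \<equiv> induced_field A B \<iota> \<xi>"

abbreviation SM :: "('a, 'a) connection" where
  "SM \<equiv> semi_symmetric (induced_metric B \<iota> g) (induced_form B \<iota> \<eta>) \<xi>\<^sub>M DM"

text \<open>The restriction of \<phi> to the submanifold, as an operation on fields; invariance puts
  the image in the range of \<open>push\<close>, where the inverse is meaningful.\<close>

definition \<phi>\<^sub>M :: "'a field \<Rightarrow> 'a field" where
  "\<phi>\<^sub>M X = (\<lambda>p. the_inv_into (tangent_space A p) (push B \<iota>) (\<phi> (\<iota> p) (push B \<iota> (X p))))"

abbreviation a :: "'a \<Rightarrow> real" where "a p \<equiv> f1 (\<iota> p) - f3 (\<iota> p)"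

lemma structure_tensors: "tensor_field_1_1 B \<phi>" "\<xi> \<in> vector_fields B" "one_form B \<eta>"
  and phi_square: "u \<in> tangent_space B q \<Longrightarrow> \<phi> q (\<phi> q u) = - u + \<eta> q u *\<^sub>R \<xi> q"
  and eta_xi: "\<eta> q (\<xi> q) = 1"
  and metric_xi: "u \<in> tangent_space B q \<Longrightarrow> g q u (\<xi> q) = \<eta> q u"
  using acm by (simp_all add: almost_contact_metric_def)

lemma push_xi: "push B \<iota> (\<xi>\<^sub>M p) = \<xi> (\<iota> p)"
  using push_the_inv(2)[OF invariant(1)] by (simp add: induced_field_def)

text \<open>\<open>induced_field\<close> inverts \<open>push\<close> point by point, so smoothness
  is not automatic and comes from \<open>lift_smooth\<close>.\<close>

lemma xi_field: "\<xi>\<^sub>M \<in> vector_fields A"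
  by (rule lift_smooth[OF compose_field_along[OF structure_tensors(2)] _ push_xi])
     (simp add: induced_field_def push_the_inv(1)[OF invariant(1)])

lemma push_phi:
  assumes "X \<in> vector_fields A"
  shows "push B \<iota> (\<phi>\<^sub>M X p) = \<phi> (\<iota> p) (push B \<iota> (X p))" and "\<phi>\<^sub>M X p \<in> tangent_space A p"
proof -
  have "\<phi> (\<iota> p) (push B \<iota> (X p)) \<in> push B \<iota> ` tangent_space A p"
    using invariant(2) A.vector_field_tangent[OF assms] by blast
  from push_the_inv[OF this]
  show "push B \<iota> (\<phi>\<^sub>M X p) = \<phi> (\<iota> p) (push B \<iota> (X p))" "\<phi>\<^sub>M X p \<in> tangent_space A p"
    by (simp_all add: \<phi>\<^sub>M_def)
qed

lemma phi_field: "X \<in> vector_fields A \<Longrightarrow> \<phi>\<^sub>M X \<in> vector_fields A"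
  by (rule lift_smooth[OF tensor_along[OF structure_tensors(1) push_field_along]])
     (simp_all add: push_phi)

text \<open>Pushing \<open>\<xi>\<^sub>M\<close> gives the restriction of the ambient \<xi>, so the
  chain rule for the pullback applies and the structure equation supplies the derivative. Invariance
  makes the result tangential.\<close>

lemma DI_xi:
  assumes X: "X \<in> vector_fields A"
  shows "DI p (X p) (\<lambda>q. push B \<iota> (\<xi>\<^sub>M q)) = push B \<iota> ((- a p) *\<^sub>R \<phi>\<^sub>M X p)"
proof -
  note Xp = A.vector_field_tangent[OF X, of p]
  obtain X' where X': "X' \<in> vector_fields B" "X' (\<iota> p) = push B \<iota> (X p)"
    by (rule B.vector_field_through[OF push_tangent[OF Xp]])
  have "cov DB X' \<xi> (\<iota> p) = (- (f1 (\<iota> p) - f3 (\<iota> p))) *\<^sub>R \<phi> (\<iota> p) (X' (\<iota> p))"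
    using structure_eqs X'(1) unfolding structure_equations_def by blast
  then show ?thesis
    by (simp only: cov_def X'(2) push_xi pullback_compose[OF DI Xp structure_tensors(2)] push_scale push_phi(1)[OF X])
qed

lemma h_xi:
  assumes "X \<in> vector_fields A"
  shows "h X \<xi>\<^sub>M p = 0"
  by (rule h_eq_0[OF assms xi_field]) (use DI_xi[OF assms] A.tangent_scale push_phi(2)[OF assms] in auto)

lemma DM_xi:
  assumes X: "X \<in> vector_fields A"
  shows "DM p (X p) \<xi>\<^sub>M = (- a p) *\<^sub>R \<phi>\<^sub>M X p"
proof (rule inj_onD[OF push_inj[of p]])
  show "push B \<iota> (DM p (X p) \<xi>\<^sub>M) = push B \<iota> ((- a p) *\<^sub>R \<phi>\<^sub>M X p)"
    using h_xi[OF X, of p] unfolding h_apply DI_xi[OF X] by (simp only: right_minus_eq)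
qed (rule DM_tangent[OF xi_field A.vector_field_tangent[OF X]]
    A.tangent_scale[OF A.vector_field_tangent[OF phi_field[OF X]]])+

text \<open>The sign is written as a scalar factor because \<open>push_scale\<close> and
  \<open>linear_over\<close> know only sums and multiples.\<close>

lemma phi_phi:
  assumes X: "X \<in> vector_fields A"
  shows "\<phi>\<^sub>M (\<phi>\<^sub>M X) p = (- 1) *\<^sub>R X p + \<eta> (\<iota> p) (push B \<iota> (X p)) *\<^sub>R \<xi>\<^sub>M p"
proof (rule inj_onD[OF push_inj[of p]])
  show "push B \<iota> (\<phi>\<^sub>M (\<phi>\<^sub>M X) p) = push B \<iota> ((- 1) *\<^sub>R X p + \<eta> (\<iota> p) (push B \<iota> (X p)) *\<^sub>R \<xi>\<^sub>M p)"
    by (simp only: push_phi(1) phi_field X phi_square[OF push_tangent[OF A.vector_field_tangent[OF X]]]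
        push_add push_scale push_xi) simp
qed (intro A.tangent_add A.tangent_scale A.vector_field_tangent phi_field xi_field X)+

lemma cov_SM: "cov SM X Y = (\<lambda>p. DM p (X p) Y + \<eta> (\<iota> p) (push B \<iota> (Y p)) *\<^sub>R X p
    - g (\<iota> p) (push B \<iota> (X p)) (push B \<iota> (Y p)) *\<^sub>R \<xi>\<^sub>M p)"
  by (simp only: cov_def semi_symmetric_def induced_metric_def induced_form_def)

lemma SM_field:
  assumes "X \<in> vector_fields A" "Y \<in> vector_fields A"
  shows "cov SM X Y \<in> vector_fields A"
  unfolding cov_SM
  by (intro A.vector_field_diff A.vector_field_add A.vector_field_scale DM_field assms xi_field
      one_form_along[OF structure_tensors(3)] metric_smooth_along push_field_along)

lemma recurrent_identity:
  assumes R: "recurrent A B \<iota> g SI SM h" and X: "X \<in> vector_fields A" and Y: "Y \<in> vector_fields A"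
  shows "h X Y p = a p *\<^sub>R h (\<phi>\<^sub>M X) Y p"
proof -
  \<comment> \<open>An equation between fields, not only at p, because the field is differentiated
    next.\<close>
  have h0: "h Z \<xi>\<^sub>M = 0" if "Z \<in> vector_fields A" for Z
    using h_xi[OF that] by (simp only: fun_eq_iff[of "h Z \<xi>\<^sub>M"] zero_fun_apply) simp
  let ?Z = "cov SM X \<xi>\<^sub>M"
  note Z = SM_field[OF X xi_field]
  obtain \<omega> where "cov_second_form A B \<iota> g SI SM h X Y \<xi>\<^sub>M p = \<omega> p (X p) *\<^sub>R h Y \<xi>\<^sub>M p"
    using R X Y xi_field unfolding recurrent_def by blast
  \<comment> \<open>Of the three terms of the covariant derivative of h, only the one with the
    derivative of \<xi> survives.\<close>
  then have "normal_part A B \<iota> g p (SI p (X p) 0) - 0 - h Y ?Z p = 0"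
    by (simp only: cov_second_form_def h0 Y SM_field[OF X Y] fun_diff_def cov_def[of SI] zero_fun_apply scaleR_zero_right)
  then have "h Y ?Z p = 0"
    by (simp only: connection_0[OF SI A.vector_field_tangent[OF X]] normal_part_0 diff_0 diff_self neg_equal_0_iff_equal)
  then have 0: "h ?Z Y p = 0" by (simp only: h_sym[OF Y Z])
  have Zp: "?Z p = (- a p) *\<^sub>R \<phi>\<^sub>M X p + X p + (- \<eta> (\<iota> p) (push B \<iota> (X p))) *\<^sub>R \<xi>\<^sub>M p"
    unfolding cov_SM DM_xi[OF X] push_xi eta_xi metric_xi[OF push_tangent[OF A.vector_field_tangent[OF X]]]
    by (simp only: scaleR_one scaleR_minus_left diff_conv_add_uminus)
  \<comment> \<open>\<open>?H\<close> is h( . , Y) at p as a map of vectors, so that the pointwise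
    value \<open>Zp\<close> can be inserted.\<close>
  let ?H = "\<lambda>v. DI p v (\<lambda>q. push B \<iota> (Y q)) - push B \<iota> (DM p v Y)"
  have H: "?H (X p) = h X Y p" for X by (simp only: h_apply)
  note lin = h_linear[OF Y, of p, unfolded linear_over_def]
  note add = lin[THEN conjunct1, rule_format] and scale = lin[THEN conjunct2, rule_format]
  note tang = A.vector_field_tangent[OF phi_field[OF X], of p] A.vector_field_tangent[OF X, of p]
    A.vector_field_tangent[OF xi_field, of p]
  have "?H (?Z p) = (- a p) *\<^sub>R ?H (\<phi>\<^sub>M X p) + ?H (X p) + (- \<eta> (\<iota> p) (push B \<iota> (X p))) *\<^sub>R ?H (\<xi>\<^sub>M p)"
    unfolding Zp by (simp only: add scale tang A.tangent_add A.tangent_scale)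
  then have "h ?Z Y p = (- a p) *\<^sub>R h (\<phi>\<^sub>M X) Y p + h X Y p + (- \<eta> (\<iota> p) (push B \<iota> (X p))) *\<^sub>R h \<xi>\<^sub>M Y p"
    by (simp only: H)
  then have "(- a p) *\<^sub>R h (\<phi>\<^sub>M X) Y p + h X Y p = 0"
    by (simp only: 0 h_sym[OF xi_field Y] h_xi[OF Y] scaleR_zero_right add_0_right)
  then show ?thesis by (simp only: scaleR_minus_left uminus_add_conv_diff right_minus_eq)
qed

lemma recurrent_imp_totally_geodesic:
  assumes R: "recurrent A B \<iota> g SI SM h"
  shows "totally_geodesic A h"
  unfolding totally_geodesic_def
proof (intro ballI, rule ext)
  fix X Y p assume X: "X \<in> vector_fields A" and Y: "Y \<in> vector_fields A"
  let ?H = "\<lambda>v. DI p v (\<lambda>q. push B \<iota> (Y q)) - push B \<iota> (DM p v Y)"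
  have H: "?H (X p) = h X Y p" for X by (simp only: h_apply)
  note lin = h_linear[OF Y, of p, unfolded linear_over_def]
  note add = lin[THEN conjunct1, rule_format] and scale = lin[THEN conjunct2, rule_format]
  \<comment> \<open>The \<xi> component drops out: symmetry turns h(\<xi>, Y) into h(Y, \<xi>) =
    0.\<close>
  have "?H (\<phi>\<^sub>M (\<phi>\<^sub>M X) p) = (- 1) *\<^sub>R ?H (X p) + \<eta> (\<iota> p) (push B \<iota> (X p)) *\<^sub>R ?H (\<xi>\<^sub>M p)"
    unfolding phi_phi[OF X]
    by (simp only: add scale A.vector_field_tangent X xi_field A.tangent_scale)
  then have "h (\<phi>\<^sub>M (\<phi>\<^sub>M X)) Y p = (- 1) *\<^sub>R h X Y p"
    by (simp only: H h_sym[OF xi_field Y] h_xi[OF Y] scaleR_zero_right add_0_right)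
  then have "h X Y p = a p *\<^sub>R a p *\<^sub>R (- 1) *\<^sub>R h X Y p"
    using recurrent_identity[OF R X Y, of p] recurrent_identity[OF R phi_field[OF X] Y, of p] by simp
  then have "((a p)\<^sup>2 + 1) *\<^sub>R h X Y p = 0"
    by (simp add: scaleR_left_distrib power2_eq_square) (metis add.commute add.right_inverse)
  moreover have "(a p)\<^sup>2 + 1 \<noteq> 0" by (metis add_nonneg_eq_0_iff zero_le_one zero_le_power2 zero_neq_one)
  ultimately show "h X Y p = 0 p" by (simp only: scaleR_eq_0_iff simp_thms zero_fun_apply)
qed

text \<open>The zero form serves as a witness. Covariant derivatives of fields under
  \<open>SM\<close> are again vector fields, so \<open>h\<close> vanishes on them as well.\<close>

lemma totally_geodesic_imp_recurrent:
  assumes "totally_geodesic A h"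
  shows "recurrent A B \<iota> g SI SM h"
proof -
  have h0: "h X Y = 0" if "X \<in> vector_fields A" "Y \<in> vector_fields A" for X Y
    using assms that by (simp add: totally_geodesic_def)
  have "one_form A (\<lambda>p v. 0)" by (simp add: one_form_def linear_over_def)
  moreover have "cov_second_form A B \<iota> g SI SM h X Y Z p = 0 *\<^sub>R h Y Z p"
    if "X \<in> vector_fields A" "Y \<in> vector_fields A" "Z \<in> vector_fields A" for X Y Z p
    by (simp only: cov_second_form_def h0 that SM_field fun_diff_def cov_def[of SI] zero_fun_apply
        connection_0[OF SI A.vector_field_tangent] normal_part_0 diff_self scaleR_zero_right) (simp add: zero_fun_def)
  ultimately show ?thesis unfolding recurrent_def by (intro exI[of _ "\<lambda>p v. 0"]) blast
qed

end

theorem theorem4p3: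
  fixes A :: "('a::{t2_space, second_countable_topology}, 'k::finite) atlas"
    and B :: "('b::{t2_space, second_countable_topology}, 'l::finite) atlas"
    and \<iota> :: "'a \<Rightarrow> 'b"
    and g :: "'b metric" and \<phi> :: "'b \<Rightarrow> 'b tangent \<Rightarrow> 'b tangent"
    and \<xi> :: "'b field" and \<eta> :: "'b \<Rightarrow> 'b tangent \<Rightarrow> real"
    and n :: nat and f1 f2 f3 :: "'b \<Rightarrow> real"
    and DB :: "('b, 'b) connection" and DM :: "('a, 'a) connection"
    and DI SI :: "('a, 'b) connection" and SM :: "('a, 'a) connection"
    and h :: "'a field \<Rightarrow> 'a field \<Rightarrow> ('a \<Rightarrow> 'b tangent)"
  assumes "generalized_sasakian_space_form n B g \<phi> \<xi> \<eta> f1 f2 f3 DB"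
    and "structure_equations B g \<phi> \<xi> \<eta> f1 f3 DB"
    and "invariant_submanifold A B \<iota> \<phi> \<xi>"
    and "levi_civita A (induced_metric B \<iota> g) DM"
    and "pullback_connection A B \<iota> DB DI"
    and "pullback_connection A B \<iota> (semi_symmetric g \<eta> \<xi> DB) SI"
  defines "SM \<equiv> semi_symmetric (induced_metric B \<iota> g) (induced_form B \<iota> \<eta>) (induced_field A B \<iota> \<xi>) DM"
    and "h \<equiv> second_fundamental_form B \<iota> DI DM"
  assumes "\<forall>p. (f1 (\<iota> p) - f3 (\<iota> p))\<^sup>2 + 1 \<noteq> 0"
  shows "recurrent A B \<iota> g SI SM h \<longleftrightarrow> totally_geodesic A h"
proof -
  have B: "smooth_manifold B" "almost_contact_metric B g \<phi> \<xi> \<eta>" "levi_civita B g DB"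
    using assms(1) by (simp_all add: generalized_sasakian_space_form_def)
  have inv: "smooth_manifold A" "smooth_map A B \<iota>" "inj_on (push B \<iota>) (tangent_space A p)"
    "\<xi> (\<iota> p) \<in> push B \<iota> ` tangent_space A p"
    "\<phi> (\<iota> p) ` push B \<iota> ` tangent_space A p \<subseteq> push B \<iota> ` tangent_space A p" for p
    using assms(3) by (simp_all add: invariant_submanifold_def immersion_def)
  interpret invariant_immersion A B \<iota> g DB DI DM \<phi> \<xi> \<eta> f1 f3 SI
    by unfold_locales
       (use B inv assms(2,4,5,6) in \<open>auto simp: almost_contact_metric_def pullback_connection_def\<close>)
  show ?thesis
    unfolding SM_def h_def
    using recurrent_imp_totally_geodesic totally_geodesic_imp_recurrent by blast
qed

end
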